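(* Let $n\ge 3$, $d\ge 1$, let $\delta=\sum_{i=1}^n\varepsilon_i\,dx_i\otimes dx_i$ with $\varepsilon_i=\pm1$ on $\mathbb R^n$, let $(F^d,g_F)$ be a semi-Riemannian manifold with constant scalar curvature $\lambda_F=0$, let $\alpha\in\mathbb R^n$ be nonzero, $\xi(x)=\sum_i\alpha_ix_i$, and assume $\|\alpha\|^2=\sum_i\varepsilon_i\alpha_i^2\neq0$. Let $\varphi>0$ be a given smooth function on $(a,b)$, and let $f,h:(a,b)\to(0,\infty)$ be smooth. Then the metric $$g=\frac{\delta}{\varphi(\xi(x))^2}+f(\xi(x))^2g_F\quad\text{on }\xi^{-1}((a,b))\times F^d$$ is a steady gradient Yamabe soliton with potential function $h\circ\xi$ with $h'=0$ if and only if $$h(\xi)=\text{constant},\qquad f(\xi)=\varphi^{\frac{n-2}{d+1}}(\xi)\,e^{\Phi(\xi)}\left(\int e^{-(d+1)\Phi(\xi)}\,d\xi+\frac{2}{d+1}C\right)^{\frac{2}{d+1}},$$ where $C$ is a constant, $\Phi(\xi)=\int z_p(\xi)\,d\xi$ and $z_p$ is a particular solution of $$z^2+\frac{2}{d+1}z'+\frac{n+d-1}{d(d+1)^2}\left(n\Big(\frac{\varphi'}{\varphi}\Big)^2-2\frac{\varphi''}{\varphi}\right)=0 .$$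
   Context: A semi-Riemannian manifold $(M,g)$ is a gradient Yamabe soliton with potential function $u\in C^\infty(M)$ and soliton constant $\rho\in\mathbb R$ if $(S_g-\rho)g=\mathrm{Hess}_g(u)$, where $S_g$ is the scalar curvature of $g$; it is steady if $\rho=0$. Primes denote derivatives with respect to $\xi\in(a,b)$. The function $h\circ\xi$ is regarded as a function on $\xi^{-1}((a,b))\times F$ via the projection to the first factor. Integrals are indefinite (antiderivatives), determined up to additive constants.
   Formalization: The formula for f is asserted on every interval (a',b') with a<a'<b'<b, with z_p, Φ and C depending on (a',b') and a positive base of the power; a single z_p on (a,b) need not exist (φ=f=1 on ℝ). F is nonempty. *)

theory Defs
  imports "HOL-Analysis.Analysis"
begin

section \<open>Smooth functions\<close>

primrec times_differentiable_on ::
    "nat \<Rightarrow> 'a::real_normed_vector set \<Rightarrow> ('a \<Rightarrow> 'b::real_normed_vector) \<Rightarrow> bool" where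
  "times_differentiable_on 0 S u \<longleftrightarrow> continuous_on S u"
| "times_differentiable_on (Suc m) S u \<longleftrightarrow>
     (\<forall>x\<in>S. u differentiable (at x)) \<and>
     (\<forall>v. times_differentiable_on m S (\<lambda>x. frechet_derivative u (at x) v))"

text \<open>Used for open sets only.\<close>

definition smooth_on ::
    "'a::real_normed_vector set \<Rightarrow> ('a \<Rightarrow> 'b::real_normed_vector) \<Rightarrow> bool" where
  "smooth_on S u \<longleftrightarrow> (\<forall>m. times_differentiable_on m S u)"

definition partial :: "'k::finite \<Rightarrow> (real^'k \<Rightarrow> real) \<Rightarrow> real^'k \<Rightarrow> real" where
  "partial i u x = frechet_derivative u (at x) (axis i 1)"


section \<open>Smooth manifolds\<close>

text \<open>A manifold is a topological space with an indexed atlas: for an index \<open>i\<close> in \<open>charts M\<close>,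
  the map \<open>cmap M i\<close> is a chart with domain \<open>cdom M i\<close>; it is irrelevant outside that domain.
  The dimension is \<open>CARD('k)\<close>.\<close>

record ('p, 'i, 'k::finite) manifold =
  mtop :: "'p topology"
  charts :: "'i set"
  cdom :: "'i \<Rightarrow> 'p set"
  cmap :: "'i \<Rightarrow> 'p \<Rightarrow> real^'k"

abbreviation cimage :: "('p, 'i, 'k::finite, 'z) manifold_scheme \<Rightarrow> 'i \<Rightarrow> (real^'k) set" where
  "cimage M i \<equiv> cmap M i ` cdom M i"

abbreviation cinv :: "('p, 'i, 'k::finite, 'z) manifold_scheme \<Rightarrow> 'i \<Rightarrow> real^'k \<Rightarrow> 'p" where
  "cinv M i \<equiv> inv_into (cdom M i) (cmap M i)"

abbreviation transition ::
    "('p, 'i, 'k::finite, 'z) manifold_scheme \<Rightarrow> 'i \<Rightarrow> 'i \<Rightarrow> real^'k \<Rightarrow> real^'k" where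
  "transition M i j \<equiv> cmap M j \<circ> cinv M i"

definition smooth_manifold :: "('p, 'i, 'k::finite, 'z) manifold_scheme \<Rightarrow> bool" where
  "smooth_manifold M \<longleftrightarrow>
     Hausdorff_space (mtop M) \<and> second_countable (mtop M) \<and>
     topspace (mtop M) = (\<Union>i\<in>charts M. cdom M i) \<and>
     (\<forall>i\<in>charts M. openin (mtop M) (cdom M i) \<and> open (cimage M i) \<and>
        homeomorphic_map (subtopology (mtop M) (cdom M i)) (top_of_set (cimage M i)) (cmap M i)) \<and>
     (\<forall>i\<in>charts M. \<forall>j\<in>charts M.
        smooth_on (cmap M i ` (cdom M i \<inter> cdom M j)) (transition M i j))"

definition smooth_function ::
    "('p, 'i, 'k::finite, 'z) manifold_scheme \<Rightarrow> ('p \<Rightarrow> real) \<Rightarrow> bool" where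
  "smooth_function M u \<longleftrightarrow> (\<forall>i\<in>charts M. smooth_on (cimage M i) (u \<circ> cinv M i))"


section \<open>Semi-Riemannian metrics\<close>

definition diag_matrix :: "('k::finite \<Rightarrow> real) \<Rightarrow> real^'k^'k" where
  "diag_matrix s = (\<chi> i j. if i = j then s i else 0)"

text \<open>The symmetric bilinear form with matrix \<open>A\<close> has an orthonormal basis (the columns of \<open>P\<close>)
  of which exactly \<open>\<nu>\<close> vectors are of negative square.\<close>

definition has_index :: "real^'k^'k \<Rightarrow> nat \<Rightarrow> bool" where
  "has_index A \<nu> \<longleftrightarrow> (\<exists>(P :: real^'k^'k) s. invertible P \<and> (\<forall>i. s i = 1 \<or> s i = -1) \<and>
     transpose P ** A ** P = diag_matrix s \<and> card {i. s i = -1} = \<nu>)"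

text \<open>A (0,2)-tensor field is given by its matrices of components with respect to the coordinate
  frames of all charts, as functions of the coordinates, subject to the tensorial transformation
  rule under change of charts.\<close>

record ('p, 'i, 'k::finite) metric_manifold = "('p, 'i, 'k) manifold" +
  metric :: "'i \<Rightarrow> real^'k \<Rightarrow> real^'k^'k"

definition semi_riemannian_manifold :: "('p, 'i, 'k::finite) metric_manifold \<Rightarrow> bool" where
  "semi_riemannian_manifold M \<longleftrightarrow>
     smooth_manifold M \<and>
     (\<forall>i\<in>charts M. smooth_on (cimage M i) (metric M i)) \<and>
     (\<forall>i\<in>charts M. \<forall>j\<in>charts M. \<forall>x\<in>cmap M i ` (cdom M i \<inter> cdom M j).
        let J = matrix (frechet_derivative (transition M i j) (at x)) in
        metric M i x = transpose J ** metric M j (transition M i j x) ** J) \<and>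
     (\<forall>i\<in>charts M. \<forall>x\<in>cimage M i.
        transpose (metric M i x) = metric M i x \<and> invertible (metric M i x)) \<and>
     (\<exists>\<nu>. \<forall>i\<in>charts M. \<forall>x\<in>cimage M i. has_index (metric M i x) \<nu>)"

text \<open>The Levi-Civita connection and its curvature in coordinates, for a field \<open>G\<close> of metric
  coefficients; the indices are \<open>\<Gamma>\<^sup>k\<^sub>i\<^sub>j\<close> and \<open>R\<^sup>l\<^sub>i\<^sub>j\<^sub>k\<close>. With the sign convention chosen, round
  spheres have positive scalar curvature.\<close>

definition christoffel ::
    "(real^'k \<Rightarrow> real^'k^'k) \<Rightarrow> 'k::finite \<Rightarrow> 'k \<Rightarrow> 'k \<Rightarrow> real^'k \<Rightarrow> real" where
  "christoffel G k i j x = (1/2) * (\<Sum>l\<in>UNIV. matrix_inv (G x) $ k $ l *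
     (partial i (\<lambda>y. G y $ j $ l) x + partial j (\<lambda>y. G y $ i $ l) x - partial l (\<lambda>y. G y $ i $ j) x))"

definition riemann ::
    "(real^'k \<Rightarrow> real^'k^'k) \<Rightarrow> 'k::finite \<Rightarrow> 'k \<Rightarrow> 'k \<Rightarrow> 'k \<Rightarrow> real^'k \<Rightarrow> real" where
  "riemann G l i j k x =
     partial j (christoffel G l i k) x - partial k (christoffel G l i j) x +
     (\<Sum>m\<in>UNIV. christoffel G l j m x * christoffel G m i k x
              - christoffel G l k m x * christoffel G m i j x)"

definition ricci ::
    "(real^'k \<Rightarrow> real^'k^'k) \<Rightarrow> 'k::finite \<Rightarrow> 'k \<Rightarrow> real^'k \<Rightarrow> real" where
  "ricci G i k x = (\<Sum>l\<in>UNIV. riemann G l i l k x)"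

definition scalar_curvature ::
    "('p, 'i, 'k::finite) metric_manifold \<Rightarrow> 'i \<Rightarrow> real^'k \<Rightarrow> real" where
  "scalar_curvature M c x =
     (\<Sum>i\<in>UNIV. \<Sum>k\<in>UNIV. matrix_inv (metric M c x) $ i $ k * ricci (metric M c) i k x)"

definition hessian ::
    "('p, 'i, 'k::finite) metric_manifold \<Rightarrow> ('p \<Rightarrow> real) \<Rightarrow> 'i \<Rightarrow> real^'k \<Rightarrow> real^'k^'k" where
  "hessian M u c x = (let v = u \<circ> cinv M c in
     \<chi> i j. partial i (partial j v) x
           - (\<Sum>k\<in>UNIV. christoffel (metric M c) k i j x * partial k v x))"

definition has_constant_scalar_curvature ::
    "('p, 'i, 'k::finite) metric_manifold \<Rightarrow> real \<Rightarrow> bool" where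
  "has_constant_scalar_curvature M \<sigma> \<longleftrightarrow>
     (\<forall>c\<in>charts M. \<forall>x\<in>cimage M c. scalar_curvature M c x = \<sigma>)"

definition gradient_yamabe_soliton ::
    "('p, 'i, 'k::finite) metric_manifold \<Rightarrow> ('p \<Rightarrow> real) \<Rightarrow> real \<Rightarrow> bool" where
  "gradient_yamabe_soliton M u \<rho> \<longleftrightarrow>
     semi_riemannian_manifold M \<and> smooth_function M u \<and>
     (\<forall>c\<in>charts M. \<forall>x\<in>cimage M c.
        (scalar_curvature M c x - \<rho>) *\<^sub>R metric M c x = hessian M u c x)"

abbreviation steady_gradient_yamabe_soliton ::
    "('p, 'i, 'k::finite) metric_manifold \<Rightarrow> ('p \<Rightarrow> real) \<Rightarrow> bool" where
  "steady_gradient_yamabe_soliton M u \<equiv> gradient_yamabe_soliton M u 0"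


section \<open>Warped products\<close>

text \<open>An open subset of \<open>\<real>\<^sup>n\<close> with a metric given in the standard coordinates.\<close>

definition open_submanifold ::
    "(real^'n) set \<Rightarrow> (real^'n \<Rightarrow> real^'n^'n) \<Rightarrow> (real^'n, unit, 'n::finite) metric_manifold" where
  "open_submanifold D G =
     \<lparr>mtop = top_of_set D, charts = {()}, cdom = (\<lambda>_. D), cmap = (\<lambda>_ x. x), metric = (\<lambda>_. G)\<rparr>"

definition join_vec :: "real^'n::finite \<Rightarrow> real^'k::finite \<Rightarrow> real^('n + 'k)" where
  "join_vec x y = (\<chi> s. case s of Inl i \<Rightarrow> x $ i | Inr j \<Rightarrow> y $ j)"

definition fst_vec :: "real^('n::finite + 'k::finite) \<Rightarrow> real^'n" where
  "fst_vec z = (\<chi> i. z $ Inl i)"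

definition snd_vec :: "real^('n::finite + 'k::finite) \<Rightarrow> real^'k" where
  "snd_vec z = (\<chi> j. z $ Inr j)"

definition block_diag :: "real^'n^'n::finite \<Rightarrow> real^'k^'k::finite \<Rightarrow> real^('n + 'k)^('n + 'k)" where
  "block_diag A B = (\<chi> r s. case (r, s) of
       (Inl i, Inl j) \<Rightarrow> A $ i $ j
     | (Inr i, Inr j) \<Rightarrow> B $ i $ j
     | _ \<Rightarrow> 0)"

text \<open>\<open>B \<times> F\<close> with the product charts and the metric \<open>g\<^sub>B + w\<^sup>2 g\<^sub>F\<close>, for a function \<open>w\<close> on \<open>B\<close>.\<close>

definition warped_product ::
    "('b, 'i, 'n::finite) metric_manifold \<Rightarrow> ('b \<Rightarrow> real) \<Rightarrow> ('p, 'j, 'k::finite) metric_manifold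
       \<Rightarrow> ('b \<times> 'p, 'i \<times> 'j, 'n + 'k) metric_manifold" where
  "warped_product B w F =
     \<lparr>mtop = prod_topology (mtop B) (mtop F),
      charts = charts B \<times> charts F,
      cdom = (\<lambda>(i, j). cdom B i \<times> cdom F j),
      cmap = (\<lambda>(i, j) (p, q). join_vec (cmap B i p) (cmap F j q)),
      metric = (\<lambda>(i, j) z. block_diag (metric B i (fst_vec z))
                  ((w (cinv B i (fst_vec z)))\<^sup>2 *\<^sub>R metric F j (snd_vec z)))\<rparr>"


section \<open>The Riccati equation\<close>

definition riccati_solution_on ::
    "real set \<Rightarrow> nat \<Rightarrow> nat \<Rightarrow> (real \<Rightarrow> real) \<Rightarrow> (real \<Rightarrow> real) \<Rightarrow> bool" where
  "riccati_solution_on J n d \<phi> z \<longleftrightarrow> (\<forall>s\<in>J. z differentiable (at s) \<and>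
     (z s)\<^sup>2 + 2 / (real d + 1) * deriv z s
       + (real n + real d - 1) / (real d * (real d + 1)\<^sup>2) *
         (real n * (deriv \<phi> s / \<phi> s)\<^sup>2 - 2 * (deriv (deriv \<phi>) s / \<phi> s)) = 0)"

definition antiderivative_on ::
    "real set \<Rightarrow> (real \<Rightarrow> real) \<Rightarrow> (real \<Rightarrow> real) \<Rightarrow> bool" where
  "antiderivative_on J u U \<longleftrightarrow> (\<forall>s\<in>J. (U has_real_derivative u s) (at s))"

text \<open>The general solution built from a particular solution of the Riccati equation. The base of
  the fractional power is required to be positive, as \<open>powr\<close> with a negative base is a
  convention of the library. A particular solution of a Riccati equation need not extend to the
  whole interval of definition of the coefficients, whence the set \<open>J\<close>. For instance, if \<open>\<phi>\<close> is
  constant on \<open>\<real>\<close>, then \<open>z = 0\<close> is the only solution on \<open>\<real>\<close>, and it does not represent the constant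
  functions \<open>f\<close> there; on a bounded interval they are represented by means of another \<open>z\<close>.\<close>

definition riccati_representation_on ::
    "real set \<Rightarrow> nat \<Rightarrow> nat \<Rightarrow> (real \<Rightarrow> real) \<Rightarrow> (real \<Rightarrow> real) \<Rightarrow> bool" where
  "riccati_representation_on J n d \<phi> f \<longleftrightarrow>
     (\<exists>z \<Phi> E C. riccati_solution_on J n d \<phi> z \<and>
        antiderivative_on J z \<Phi> \<and>
        antiderivative_on J (\<lambda>s. exp (- (real d + 1) * \<Phi> s)) E \<and>
        (\<forall>s\<in>J. E s + 2 / (real d + 1) * C > 0 \<and>
           f s = \<phi> s powr ((real n - 2) / (real d + 1)) * exp (\<Phi> s) *
                 (E s + 2 / (real d + 1) * C) powr (2 / (real d + 1))))"

end

theory Submission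
  imports Defs
begin

text \<open>Write \<open>\<phi> = exp(-p)\<close> and \<open>f = exp(q)\<close>, so that the metric is
  \<open>g = exp(2p) \<delta> + exp(2q) g\<^sub>F\<close> with \<open>p\<close> and \<open>q\<close> evaluated at \<open>\<xi>\<close>. The potential is constant along the whole
  product as soon as \<open>h' = 0\<close>, hence its Hessian vanishes, and since a metric is nowhere zero the
  soliton equation says exactly that the scalar curvature of \<open>g\<close> is zero
  (\<open>steady_soliton_of_constant_iff\<close>). That \<open>g\<close> is a semi-Riemannian metric at all is a general fact
  on warped products (\<open>semi_riemannian_warped_product\<close>).

  In product coordinates the Christoffel symbols of \<open>g\<close> are explicit in \<open>p'\<close>, \<open>q'\<close> and those of
  \<open>g\<^sub>F\<close>, and contracting the Ricci tensor gives (\<open>scalar_curvature_trace\<close>), with \<open>N = \<parallel>\<alpha>\<parallel>\<^sup>2\<close>,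
  \<open>S = exp(-2q) S\<^sub>F - N exp(-2p) (2(n-1)p'' + 2dq'' + (n-1)(n-2)p'\<^sup>2 + d(d+1)q'\<^sup>2 + 2d(n-2)p'q')\<close>.
  As \<open>S\<^sub>F = 0\<close>, \<open>N \<noteq> 0\<close> and \<open>\<xi>\<close> takes every value in the interval, flatness is the vanishing of the
  bracket on the interval. Completing the square, that is, passing from \<open>q'\<close> to the function
  \<open>\<zeta> = q' + (n-2)/(d+1) p'\<close>, removes the product \<open>p'q'\<close> and turns the bracket into \<open>d(d+1)\<close> times
  the left-hand side of the Riccati equation at \<open>z = \<zeta>\<close> (\<open>conformal_riccati\<close>).

  Now \<open>\<zeta>\<close> is the logarithmic derivative of \<open>f \<phi> powr (-k)\<close>, \<open>k = (n-2)/(d+1)\<close>, and the formula for \<open>f\<close> is the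
  classical description of all solutions of a Riccati equation by a particular one: it says
  \<open>\<zeta> = z + 2/(d+1) w\<close>, where \<open>w\<close> is the logarithmic derivative of \<open>\<integral>exp(-(d+1)\<Phi>) + const\<close>. Such
  a \<open>w\<close> solves the Bernoulli equation \<open>w' = -(d+1)zw - w\<^sup>2\<close>, and adding \<open>2/(d+1) w\<close> maps solutions to
  solutions (\<open>riccati_shift\<close>). Conversely, \<open>w\<close> has no zero, so a given \<open>\<zeta>\<close> must be compared with a
  solution \<open>z\<close> that differs from it everywhere. In terms of \<open>\<lambda> = ln (f \<phi> powr (-k))\<close> one can take
  \<open>z = (\<lambda> + 2/(d+1) ln W)'\<close> for any positive \<open>W\<close> with \<open>W' = -exp(-(d+1)\<lambda>)\<close>; a positive \<open>W\<close> exists where the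
  integral of \<open>exp(-(d+1)\<lambda>)\<close> is bounded, which is the reason for compactly contained subintervals
  (\<open>riccati_imp_riccati_representation\<close>).\<close>

section \<open>Calculus of smooth functions on open sets\<close>

lemma has_derivative_cong_open:
  assumes "open S" "x \<in> S" "\<And>y. y \<in> S \<Longrightarrow> u y = v y"
  shows "(u has_derivative D) (at x) \<longleftrightarrow> (v has_derivative D) (at x)"
proof
  assume "(u has_derivative D) (at x)"
  from has_derivative_transform_within_open[OF this assms] show "(v has_derivative D) (at x)" .
next
  assume "(v has_derivative D) (at x)"
  from has_derivative_transform_within_open[OF this assms(1,2) assms(3)[symmetric]]
  show "(u has_derivative D) (at x)" .
qed

lemma frechet_derivative_cong_open:
  assumes "open S" "x \<in> S" "\<And>y. y \<in> S \<Longrightarrow> u y = v y"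
  shows "frechet_derivative u (at x) = frechet_derivative v (at x)"
  using has_derivative_cong_open[of S x u v, OF assms] by (simp only: frechet_derivative_def)

lemma differentiable_cong_open:
  assumes "open S" "x \<in> S" "\<And>y. y \<in> S \<Longrightarrow> u y = v y" "u differentiable (at x)"
  shows "v differentiable (at x)"
  using assms(4) has_derivative_cong_open[of S x u v, OF assms(1-3)] unfolding differentiable_def by blast

lemma times_differentiable_on_cong:
  assumes "open S" "\<And>x. x \<in> S \<Longrightarrow> u x = v x" "times_differentiable_on m S u"
  shows "times_differentiable_on m S v"
  using assms(2,3)
proof (induction m arbitrary: u v)
  case 0
  then show ?case by (simp cong: continuous_on_cong)
next
  case (Suc m)
  have "frechet_derivative u (at x) = frechet_derivative v (at x)" if "x \<in> S" for x
    by (rule frechet_derivative_cong_open[of S x u v, OF \<open>open S\<close> that Suc.prems(1)])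
  note eq = this
  have "times_differentiable_on m S (\<lambda>x. frechet_derivative v (at x) w)" for w
    by (rule Suc.IH[where u = "\<lambda>x. frechet_derivative u (at x) w"])
       (use eq Suc.prems(2) in auto)
  moreover have "v differentiable (at x)" if "x \<in> S" for x
    using differentiable_cong_open[of S x u v, OF \<open>open S\<close> that Suc.prems(1)] Suc.prems(2) that by auto
  ultimately show ?case by simp
qed

text \<open>Establishes \<^const>\<open>times_differentiable_on\<close> from any explicit formula for the derivative, so that
  the closure properties below follow by induction from the differentiation rules.\<close>

lemma times_differentiable_on_SucI:
  assumes "open S"
    and "\<And>x. x \<in> S \<Longrightarrow> (u has_derivative D x) (at x)"
    and "\<And>w. times_differentiable_on m S (\<lambda>x. D x w)"
  shows "times_differentiable_on (Suc m) S u"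
proof -
  have "times_differentiable_on m S (\<lambda>x. frechet_derivative u (at x) w)" for w
    by (rule times_differentiable_on_cong[OF assms(1) _ assms(3)])
       (simp add: frechet_derivative_at[OF assms(2)])
  then show ?thesis using assms(2) by (auto simp: differentiable_def)
qed

lemma times_differentiable_on_SucD:
  "times_differentiable_on (Suc m) S u \<Longrightarrow> times_differentiable_on m S u"
proof (induction m arbitrary: u)
  case 0
  then show ?case
    by (simp add: continuous_at_imp_continuous_on differentiable_imp_continuous_within)
next
  case (Suc m)
  then show ?case by (metis times_differentiable_on.simps(2))
qed

lemma times_differentiable_on_derivative:
  assumes "times_differentiable_on (Suc m) S u" "x \<in> S"
  shows "(u has_derivative frechet_derivative u (at x)) (at x)"
  using assms by (simp add: frechet_derivative_works)

lemma times_differentiable_on_const: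
  assumes "open S" shows "times_differentiable_on m S (\<lambda>x. c)"
proof (induction m arbitrary: c)
  case (Suc m)
  show ?case
    by (rule times_differentiable_on_SucI[OF assms, where D = "\<lambda>x w. 0"]) (auto intro: Suc)
qed simp

lemma times_differentiable_on_bounded_linear_image:
  assumes "open S" "bounded_linear L" "times_differentiable_on m S u"
  shows "times_differentiable_on m S (\<lambda>x. L (u x))"
  using assms(3)
proof (induction m arbitrary: u)
  case 0
  then show ?case using bounded_linear.continuous_on[OF assms(2)] by simp
next
  case (Suc m)
  show ?case
    by (rule times_differentiable_on_SucI[OF assms(1)
          bounded_linear.has_derivative[OF assms(2) times_differentiable_on_derivative[OF Suc.prems]]])
       (use Suc in auto)
qed

lemma times_differentiable_on_compose_bounded_linear:
  assumes "open S" "bounded_linear L" "L ` S \<subseteq> T" "times_differentiable_on m T u"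
  shows "times_differentiable_on m S (\<lambda>x. u (L x))"
  using assms(4)
proof (induction m arbitrary: u)
  case 0
  then have "continuous_on T u" by simp
  from continuous_on_compose2[OF this linear_continuous_on[OF assms(2)] assms(3)]
  show ?case by simp
next
  case (Suc m)
  show ?case
  proof (rule times_differentiable_on_SucI[OF assms(1)])
    fix x assume "x \<in> S"
    then have "L x \<in> T" using assms(3) by auto
    then show "((\<lambda>x. u (L x)) has_derivative (\<lambda>w. frechet_derivative u (at (L x)) (L w))) (at x)"
      using has_derivative_compose[OF bounded_linear_imp_has_derivative[OF assms(2)]
          times_differentiable_on_derivative[OF Suc.prems]] by auto
  next
    fix w show "times_differentiable_on m S (\<lambda>x. frechet_derivative u (at (L x)) (L w))"
      by (rule Suc.IH) (use Suc.prems in auto)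
  qed
qed

lemma times_differentiable_on_add:
  assumes "open S" "times_differentiable_on m S u" "times_differentiable_on m S v"
  shows "times_differentiable_on m S (\<lambda>x. u x + v x)"
  using assms(2,3)
proof (induction m arbitrary: u v)
  case 0
  then show ?case by (simp add: continuous_on_add)
next
  case (Suc m)
  show ?case
    by (rule times_differentiable_on_SucI[OF assms(1)
          has_derivative_add[OF times_differentiable_on_derivative[OF Suc.prems(1)]
            times_differentiable_on_derivative[OF Suc.prems(2)]]])
       (use Suc in auto)
qed

lemma times_differentiable_on_bilinear:
  assumes "open S" "bounded_bilinear B"
    "times_differentiable_on m S u" "times_differentiable_on m S v"
  shows "times_differentiable_on m S (\<lambda>x. B (u x) (v x))"
  using assms(3,4)
proof (induction m arbitrary: u v)
  case 0
  then show ?case by (simp add: bounded_bilinear.continuous_on[OF assms(2)])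
next
  case (Suc m)
  note IH = Suc.IH and uv = Suc.prems and uv' = Suc.prems[THEN times_differentiable_on_SucD]
  show ?case
    by (rule times_differentiable_on_SucI[OF assms(1)
          bounded_bilinear.FDERIV[OF assms(2) times_differentiable_on_derivative[OF uv(1)]
            times_differentiable_on_derivative[OF uv(2)]]])
       (use uv uv' in \<open>auto intro!: times_differentiable_on_add[OF assms(1)] IH\<close>)
qed

text \<open>The derivative of the inverse contains the inverse itself, undifferentiated: smoothness of order
  \<open>m\<close> of the inverse, known by induction, gives smoothness of order \<open>m + 1\<close>.\<close>

lemma times_differentiable_on_inverse:
  fixes u :: "'a::real_normed_vector \<Rightarrow> real"
  assumes "open S" "\<And>x. x \<in> S \<Longrightarrow> u x \<noteq> 0" "times_differentiable_on m S u"
  shows "times_differentiable_on m S (\<lambda>x. inverse (u x))"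
  using assms(3)
proof (induction m)
  case 0
  then show ?case using assms(2) by (auto intro: continuous_on_inverse)
next
  case (Suc m)
  note mult = times_differentiable_on_bilinear[OF assms(1) bounded_bilinear_mult]
  have inv: "times_differentiable_on m S (\<lambda>x. inverse (u x))"
    using Suc times_differentiable_on_SucD by blast
  show ?case
  proof (rule times_differentiable_on_SucI[OF assms(1)])
    fix x assume x: "x \<in> S"
    show "((\<lambda>x. inverse (u x)) has_derivative
        (\<lambda>w. - (inverse (u x) * frechet_derivative u (at x) w * inverse (u x)))) (at x)"
      by (rule Deriv.has_derivative_inverse[OF assms(2)[OF x] times_differentiable_on_derivative[OF Suc.prems x]])
  next
    fix w
    have "times_differentiable_on m S (\<lambda>x. frechet_derivative u (at x) w)"
      using Suc.prems by simp
    from times_differentiable_on_bounded_linear_image[OF assms(1) _ mult[OF mult[OF inv this] inv],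
        of uminus]
    show "times_differentiable_on m S
        (\<lambda>x. - (inverse (u x) * frechet_derivative u (at x) w * inverse (u x)))"
      by (simp add: bounded_linear_minus bounded_linear_ident)
  qed
qed

lemma smooth_on_cong:
  "open S \<Longrightarrow> (\<And>x. x \<in> S \<Longrightarrow> u x = v x) \<Longrightarrow> smooth_on S u \<Longrightarrow> smooth_on S v"
  unfolding smooth_on_def using times_differentiable_on_cong by blast

lemma smooth_on_const: "open S \<Longrightarrow> smooth_on S (\<lambda>x. c)"
  by (simp add: smooth_on_def times_differentiable_on_const)

lemma smooth_on_bounded_linear_image:
  "open S \<Longrightarrow> bounded_linear L \<Longrightarrow> smooth_on S u \<Longrightarrow> smooth_on S (\<lambda>x. L (u x))"
  by (simp add: smooth_on_def times_differentiable_on_bounded_linear_image)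

lemma smooth_on_compose_bounded_linear:
  "open S \<Longrightarrow> bounded_linear L \<Longrightarrow> L ` S \<subseteq> T \<Longrightarrow> smooth_on T u \<Longrightarrow> smooth_on S (\<lambda>x. u (L x))"
  unfolding smooth_on_def using times_differentiable_on_compose_bounded_linear by blast

lemma smooth_on_add:
  "open S \<Longrightarrow> smooth_on S u \<Longrightarrow> smooth_on S v \<Longrightarrow> smooth_on S (\<lambda>x. u x + v x)"
  by (simp add: smooth_on_def times_differentiable_on_add)

lemma smooth_on_bilinear:
  "open S \<Longrightarrow> bounded_bilinear B \<Longrightarrow> smooth_on S u \<Longrightarrow> smooth_on S v
    \<Longrightarrow> smooth_on S (\<lambda>x. B (u x) (v x))"
  by (simp add: smooth_on_def times_differentiable_on_bilinear)

lemma smooth_on_inverse: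
  fixes u :: "'a::real_normed_vector \<Rightarrow> real"
  shows "open S \<Longrightarrow> (\<And>x. x \<in> S \<Longrightarrow> u x \<noteq> 0) \<Longrightarrow> smooth_on S u \<Longrightarrow> smooth_on S (\<lambda>x. inverse (u x))"
  by (simp add: smooth_on_def times_differentiable_on_inverse)

lemma smooth_on_ident: "open S \<Longrightarrow> smooth_on S (\<lambda>x. x)"
  unfolding smooth_on_def
proof
  fix m assume "open S"
  show "times_differentiable_on m S (\<lambda>x. x)"
  proof (cases m)
    case (Suc k)
    show ?thesis unfolding Suc
      by (rule times_differentiable_on_SucI[OF \<open>open S\<close> has_derivative_ident])
         (rule times_differentiable_on_const[OF \<open>open S\<close>])
  qed simp
qed

lemma smooth_on_imp_differentiable: "smooth_on S u \<Longrightarrow> x \<in> S \<Longrightarrow> u differentiable (at x)"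
  unfolding smooth_on_def by (metis times_differentiable_on.simps(2))

lemma smooth_on_frechet_derivative:
  "smooth_on S u \<Longrightarrow> smooth_on S (\<lambda>x. frechet_derivative u (at x) w)"
  unfolding smooth_on_def by (metis times_differentiable_on.simps(2))

lemma smooth_on_deriv:
  fixes u :: "real \<Rightarrow> real"
  assumes "open S" "smooth_on S u"
  shows "smooth_on S (deriv u)"
proof (rule smooth_on_cong[OF assms(1) _ smooth_on_frechet_derivative[OF assms(2), of 1]])
  fix x assume "x \<in> S"
  then have "u field_differentiable (at x)"
    using smooth_on_imp_differentiable[OF assms(2)] by (simp add: real_differentiable_def field_differentiable_def)
  then have "(u has_derivative (\<lambda>w. deriv u x * w)) (at x)"
    by (simp add: DERIV_deriv_iff_field_differentiable flip: has_field_derivative_def)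
  from frechet_derivative_at[OF this]
  show "frechet_derivative u (at x) 1 = deriv u x" by (metis mult.right_neutral)
qed

lemma smooth_on_imp_DERIV:
  fixes u :: "real \<Rightarrow> real"
  assumes "smooth_on S u" "x \<in> S"
  shows "(u has_real_derivative deriv u x) (at x)"
  using smooth_on_imp_differentiable[OF assms]
  by (simp add: DERIV_deriv_iff_field_differentiable real_differentiable_def field_differentiable_def)

section \<open>Block vectors, block matrices and inverse matrices\<close>

lemma fst_vec_nth [simp]: "fst_vec z $ i = z $ Inl i"
  and snd_vec_nth [simp]: "snd_vec z $ j = z $ Inr j"
  and join_vec_nth [simp]: "join_vec x y $ Inl i = x $ i" "join_vec x y $ Inr j = y $ j"
  by (simp_all add: fst_vec_def snd_vec_def join_vec_def)

lemma fst_vec_join_vec [simp]: "fst_vec (join_vec x y) = x"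
  and snd_vec_join_vec [simp]: "snd_vec (join_vec x y) = y"
  and join_vec_fst_vec_snd_vec [simp]: "join_vec (fst_vec z) (snd_vec z) = z"
  by (simp_all add: vec_eq_iff join_vec_def split: sum.split)

lemma join_vec_inject [simp]: "join_vec x y = join_vec x' y' \<longleftrightarrow> x = x' \<and> y = y'"
  by (metis fst_vec_join_vec snd_vec_join_vec)

lemma bounded_linear_fst_vec: "bounded_linear fst_vec"
  and bounded_linear_snd_vec: "bounded_linear snd_vec"
  by (auto intro!: linearI simp: vec_eq_iff simp flip: linear_conv_bounded_linear)

lemma bounded_linear_join_vec: "bounded_linear (\<lambda>(x, y). join_vec x y)"
  by (auto intro!: linearI simp: vec_eq_iff join_vec_def simp flip: linear_conv_bounded_linear
      split: sum.split)

lemma bounded_linear_join_vec_left: "bounded_linear (\<lambda>x. join_vec x 0)"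
  and bounded_linear_join_vec_right: "bounded_linear (\<lambda>y. join_vec 0 y)"
  by (auto intro!: linearI simp: vec_eq_iff join_vec_def simp flip: linear_conv_bounded_linear
      split: sum.split)

lemma join_vec_eq_add: "join_vec x y = join_vec x 0 + join_vec 0 y"
  by (simp add: vec_eq_iff join_vec_def split: sum.split)

lemma fst_vec_axis [simp]: "fst_vec (axis (Inl i) c) = axis i c" "fst_vec (axis (Inr j) c) = 0"
  and snd_vec_axis [simp]: "snd_vec (axis (Inl i) c) = 0" "snd_vec (axis (Inr j) c) = axis j c"
  by (simp_all add: vec_eq_iff axis_def)

lemma sum_UNIV_sum:
  fixes t :: "'a::finite + 'b::finite \<Rightarrow> 'c::comm_monoid_add"
  shows "(\<Sum>s\<in>UNIV. t s) = (\<Sum>i\<in>UNIV. t (Inl i)) + (\<Sum>j\<in>UNIV. t (Inr j))"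
  using sum.Plus[of "UNIV :: 'a set" "UNIV :: 'b set" t] by (simp add: o_def)

lemma block_diag_nth [simp]:
  "block_diag A B $ Inl i $ Inl j = A $ i $ j" "block_diag A B $ Inr a $ Inr b = B $ a $ b"
  "block_diag A B $ Inl i $ Inr b = 0" "block_diag A B $ Inr a $ Inl j = 0"
  by (simp_all add: block_diag_def)

lemma sum_all_iff: "(\<forall>s. P s) \<longleftrightarrow> (\<forall>i. P (Inl i)) \<and> (\<forall>j. P (Inr j))"
  by (metis sum.exhaust)

lemma block_diag_mult: "block_diag A B ** block_diag A' B' = block_diag (A ** A') (B ** B')"
  by (auto simp: vec_eq_iff sum_all_iff matrix_matrix_mult_def sum_UNIV_sum)

lemma transpose_block_diag: "transpose (block_diag A B) = block_diag (transpose A) (transpose B)"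
  by (auto simp: vec_eq_iff sum_all_iff transpose_def)

lemma block_diag_mat: "block_diag (mat c) (mat c) = mat c"
  by (auto simp: vec_eq_iff sum_all_iff mat_def)

lemma invertible_block_diag:
  assumes "invertible A" "invertible B" shows "invertible (block_diag A B)"
proof -
  obtain A' B' where "A ** A' = mat 1" "A' ** A = mat 1" "B ** B' = mat 1" "B' ** B = mat 1"
    using assms unfolding invertible_def by blast
  then have "block_diag A B ** block_diag A' B' = mat 1 \<and> block_diag A' B' ** block_diag A B = mat 1"
    by (simp add: block_diag_mult block_diag_mat)
  then show ?thesis unfolding invertible_def by blast
qed

lemma matrix_inv_eqI:
  fixes A :: "real^'n^'n"
  assumes "A ** B = mat 1"
  shows "matrix_inv A = B"
proof -
  have BA: "B ** A = mat 1" using assms matrix_left_right_inverse by blast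
  have "A ** matrix_inv A = mat 1 \<and> matrix_inv A ** A = mat 1"
    unfolding matrix_inv_def by (rule someI[of _ B]) (simp add: assms BA)
  then have "matrix_inv A = (B ** A) ** matrix_inv A" by (simp add: BA)
  also have "\<dots> = B"
    using \<open>A ** matrix_inv A = mat 1 \<and> _\<close> by (simp flip: matrix_mul_assoc)
  finally show ?thesis .
qed

lemma matrix_inv_invertible:
  fixes A :: "real^'n^'n"
  assumes "invertible A"
  shows "A ** matrix_inv A = mat 1" "matrix_inv A ** A = mat 1"
proof -
  obtain B where B: "A ** B = mat 1" using assms unfolding invertible_def by blast
  then show "A ** matrix_inv A = mat 1" by (simp add: matrix_inv_eqI)
  then show "matrix_inv A ** A = mat 1" using matrix_left_right_inverse by blast
qed

text \<open>Cramer's rule, by which the entries of the inverse inherit differentiability.\<close>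

lemma matrix_inv_entry:
  fixes A :: "real^'n^'n"
  assumes "invertible A"
  shows "matrix_inv A $ k $ l = det (\<chi> i j. if j = k then axis l 1 $ i else A $ i $ j) / det A"
proof -
  have "A *v (matrix_inv A *v axis l 1) = axis l 1"
    by (simp add: matrix_vector_mul_assoc matrix_inv_invertible[OF assms])
  then have "matrix_inv A *v axis l 1 =
      (\<chi> k. det (\<chi> i j. if j = k then axis l 1 $ i else A $ i $ j) / det A)"
    using cramer[of A] assms by (simp add: invertible_det_nz)
  moreover have "(matrix_inv A *v axis l 1) $ k = matrix_inv A $ k $ l"
    by (simp add: matrix_vector_mul_component inner_axis)
  ultimately show ?thesis by simp
qed

lemma matrix_scaleR_mult:
  fixes A :: "real^'n^'n"
  shows "(c *\<^sub>R A) ** B = c *\<^sub>R (A ** B)" "A ** (c *\<^sub>R B) = c *\<^sub>R (A ** B)"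
  by (simp_all add: vec_eq_iff matrix_matrix_mult_def sum_distrib_left mult_ac)

lemma transpose_scaleR: "transpose (c *\<^sub>R A) = c *\<^sub>R transpose A"
  by (simp add: vec_eq_iff transpose_def)

lemma transpose_diag_matrix: "transpose (diag_matrix s) = diag_matrix s"
  by (simp add: vec_eq_iff transpose_def diag_matrix_def)

lemma diag_matrix_mult: "diag_matrix s ** diag_matrix t = diag_matrix (\<lambda>i. s i * t i)"
  by (simp add: vec_eq_iff matrix_matrix_mult_def diag_matrix_def mult_delta_left sum.delta')

lemma diag_matrix_1: "diag_matrix (\<lambda>i. 1) = mat 1"
  by (simp add: vec_eq_iff diag_matrix_def mat_def)

lemma diag_matrix_sign_square:
  assumes "\<And>i. s i = 1 \<or> s i = -1"
  shows "diag_matrix s ** diag_matrix s = mat 1"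
proof -
  have "s i * s i = 1" for i using assms[of i] by auto
  then show ?thesis by (simp add: diag_matrix_mult diag_matrix_1)
qed

lemma invertible_scaleR:
  fixes A :: "real^'n^'n"
  assumes "c \<noteq> 0" "invertible A" shows "invertible (c *\<^sub>R A)"
proof -
  have "(c *\<^sub>R A) ** ((1 / c) *\<^sub>R matrix_inv A) = mat 1" "((1 / c) *\<^sub>R matrix_inv A) ** (c *\<^sub>R A) = mat 1"
    using assms by (simp_all add: matrix_scaleR_mult matrix_inv_invertible)
  then show ?thesis unfolding invertible_def by blast
qed

section \<open>The index of a symmetric matrix\<close>

lemma has_index_diag_matrix:
  assumes "\<And>i. s i = 1 \<or> s i = -1"
  shows "has_index (diag_matrix s) (card {i. s i = -1})"
  unfolding has_index_def
  by (rule exI[of _ "mat 1"], rule exI[of _ s])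
     (auto simp: assms transpose_mat invertible_def intro: exI[of _ "mat 1"])

text \<open>An orthonormal basis of \<open>A\<close>, divided by \<open>\<surd>c\<close>, is orthonormal for \<open>c A\<close> with the same signs.\<close>

lemma has_index_scaleR:
  fixes A :: "real^'n^'n"
  assumes "c > 0" "has_index A \<nu>"
  shows "has_index (c *\<^sub>R A) \<nu>"
proof -
  obtain P :: "real^'n^'n" and s where P: "invertible P" "\<forall>i. s i = 1 \<or> s i = -1"
    "transpose P ** A ** P = diag_matrix s" "card {i. s i = -1} = \<nu>"
    using assms(2) unfolding has_index_def by blast
  define Q where "Q = (1 / sqrt c) *\<^sub>R P"
  have "transpose Q ** (c *\<^sub>R A) ** Q = (1 / sqrt c * c * (1 / sqrt c)) *\<^sub>R (transpose P ** A ** P)"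
    by (simp add: Q_def transpose_scaleR matrix_scaleR_mult)
  also have "1 / sqrt c * c * (1 / sqrt c) = 1" using assms(1) by (simp add: field_simps)
  finally have "transpose Q ** (c *\<^sub>R A) ** Q = diag_matrix s" by (simp add: P)
  moreover have "invertible Q" unfolding Q_def using assms(1) P(1) by (intro invertible_scaleR) auto
  ultimately show ?thesis unfolding has_index_def using P by blast
qed

lemma has_index_block_diag:
  fixes A :: "real^'n^'n" and B :: "real^'m^'m"
  assumes "has_index A \<nu>" "has_index B \<mu>"
  shows "has_index (block_diag A B) (\<nu> + \<mu>)"
proof -
  obtain P :: "real^'n^'n" and s where P: "invertible P" "\<forall>i. s i = 1 \<or> s i = -1"
    "transpose P ** A ** P = diag_matrix s" "card {i. s i = -1} = \<nu>"
    using assms(1) unfolding has_index_def by blast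
  obtain Q :: "real^'m^'m" and t where Q: "invertible Q" "\<forall>i. t i = 1 \<or> t i = -1"
    "transpose Q ** B ** Q = diag_matrix t" "card {i. t i = -1} = \<mu>"
    using assms(2) unfolding has_index_def by blast
  have "transpose (block_diag P Q) ** block_diag A B ** block_diag P Q = diag_matrix (case_sum s t)"
    unfolding transpose_block_diag block_diag_mult P(3) Q(3)
    by (auto simp: vec_eq_iff sum_all_iff diag_matrix_def)
  moreover have "r \<in> {r. case_sum s t r = -1} \<longleftrightarrow> r \<in> {i. s i = -1} <+> {j. t j = -1}" for r
    by (cases r) auto
  then have "{r. case_sum s t r = -1} = {i. s i = -1} <+> {j. t j = -1}" by blast
  then have "card {r. case_sum s t r = -1} = \<nu> + \<mu>"
    by (simp add: card_Plus P(4) Q(4))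
  moreover have "\<forall>r. case_sum s t r = 1 \<or> case_sum s t r = -1"
    using P(2) Q(2) by (auto split: sum.split)
  moreover have "invertible (block_diag P Q)" using P(1) Q(1) by (rule invertible_block_diag)
  ultimately show ?thesis unfolding has_index_def by blast
qed

section \<open>Partial derivatives and the differentiability of Christoffel symbols\<close>

lemma partial_eq: "(u has_derivative D) (at x) \<Longrightarrow> partial i u x = D (axis i 1)"
  unfolding partial_def using frechet_derivative_at by metis

lemma partial_cong_open:
  assumes "open S" "x \<in> S" "\<And>y. y \<in> S \<Longrightarrow> u y = v y"
  shows "partial i u x = partial i v x"
  using frechet_derivative_cong_open[of S x u v] assms by (simp add: partial_def)

lemma partial_const [simp]: "partial i (\<lambda>x. c) x = 0"
  by (rule partial_eq[where D = "\<lambda>w. 0"]) simp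

lemma smooth_on_partial: "smooth_on S u \<Longrightarrow> smooth_on S (partial i u)"
  unfolding partial_def by (rule smooth_on_frechet_derivative)

lemma differentiable_prod:
  fixes t :: "'i \<Rightarrow> 'a::real_normed_vector \<Rightarrow> real"
  assumes "finite A" "\<And>i. i \<in> A \<Longrightarrow> t i differentiable (at x)"
  shows "(\<lambda>x. \<Prod>i\<in>A. t i x) differentiable (at x)"
  using assms by (induction A rule: finite_induct) auto

lemma differentiable_det:
  fixes A :: "'a::real_normed_vector \<Rightarrow> real^'n^'n"
  assumes "\<And>i j. (\<lambda>x. A x $ i $ j) differentiable (at x)"
  shows "(\<lambda>x. det (A x)) differentiable (at x)"
  unfolding det_def using assms
  by (intro differentiable_sum differentiable_mult differentiable_const differentiable_prod)
     (auto intro!: differentiable_prod simp: finite_permutations)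

lemma differentiable_matrix_inv:
  fixes A :: "'a::real_normed_vector \<Rightarrow> real^'n^'n"
  assumes "open S" "x \<in> S" "\<And>y. y \<in> S \<Longrightarrow> invertible (A y)"
    and "\<And>i j. (\<lambda>x. A x $ i $ j) differentiable (at x)"
  shows "(\<lambda>x. matrix_inv (A x) $ k $ l) differentiable (at x)"
proof (rule differentiable_cong_open[OF assms(1,2)])
  show "det (\<chi> i j. if j = k then axis l 1 $ i else A y $ i $ j) / det (A y) = matrix_inv (A y) $ k $ l"
    if "y \<in> S" for y using matrix_inv_entry[OF assms(3)[OF that]] by simp
  show "(\<lambda>y. det (\<chi> i j. if j = k then axis l 1 $ i else A y $ i $ j) / det (A y)) differentiable (at x)"
  proof (intro differentiable_divide differentiable_det assms(4))
    show "(\<lambda>y. (\<chi> i j. if j = k then axis l 1 $ i else A y $ i $ j) $ r $ s) differentiable (at x)" for r s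
      using assms(4) by (cases "s = k") auto
    show "det (A x) \<noteq> 0" using assms(2,3) invertible_det_nz by blast
  qed
qed

lemma smooth_on_matrix_entry:
  fixes A :: "'a::real_normed_vector \<Rightarrow> real^'n^'m"
  assumes "open S" "smooth_on S A"
  shows "smooth_on S (\<lambda>x. A x $ i $ j)"
  using smooth_on_bounded_linear_image[OF assms(1) bounded_linear_compose[OF bounded_linear_vec_nth bounded_linear_vec_nth]
      assms(2)] .

text \<open>The derivative of a non-differentiable function is an arbitrary map, so that even the chain rule
  for functions of the fibre coordinates alone requires this fact.\<close>

lemma differentiable_christoffel:
  assumes "open S" "x \<in> S" "smooth_on S G" "\<And>y. y \<in> S \<Longrightarrow> invertible (G y)"
  shows "christoffel G k i j differentiable (at x)"
proof -
  have G: "smooth_on S (\<lambda>y. G y $ r $ s)" for r s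
    using smooth_on_matrix_entry[OF assms(1,3)] .
  have inv: "(\<lambda>x. matrix_inv (G x) $ r $ s) differentiable (at x)" for r s
    by (rule differentiable_matrix_inv[OF assms(1,2,4)])
       (auto intro: smooth_on_imp_differentiable[OF G assms(2)])
  have "partial m (\<lambda>y. G y $ r $ s) differentiable (at x)" for m r s
    by (rule smooth_on_imp_differentiable[OF smooth_on_partial[OF G] assms(2)])
  with inv show ?thesis
    unfolding christoffel_def[abs_def]
    by (intro differentiable_sum differentiable_mult differentiable_const differentiable_add
        differentiable_diff) auto
qed

section \<open>Curvature of the warped metric in coordinates\<close>

text \<open>The metric \<open>exp(2p) \<delta> + exp(2q) g\<^sub>F\<close> in one chart of the fibre. The functions \<open>p1\<close>, \<open>p2\<close>, \<open>q1\<close>, \<open>q2\<close> are the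
  first and second derivatives of \<open>p\<close> and \<open>q\<close>. The exponential form makes the derivatives of the metric
  along the base proportional to its blocks, so that the exponentials cancel in all Christoffel
  symbols except those with an upper base index and two fibre indices. The
  matrix field \<open>G\<close> is prescribed on the chart domain only, because a warping function on the manifold
  is evaluated at the inverse chart, which is meaningful only there.\<close>

locale warped_coordinates =
  fixes I :: "real set" and V :: "(real^'d::finite) set"
    and \<epsilon> :: "'n::finite \<Rightarrow> real" and \<alpha> :: "real^'n"
    and p p1 p2 q q1 q2 :: "real \<Rightarrow> real"
    and gF :: "real^'d \<Rightarrow> real^'d^'d"
    and G :: "real^('n + 'd) \<Rightarrow> real^('n + 'd)^('n + 'd)"
  assumes open_I: "open I" and open_V: "open V"
    and sign: "\<And>i. \<epsilon> i = 1 \<or> \<epsilon> i = -1"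
    and deriv_p: "\<And>s. s \<in> I \<Longrightarrow> (p has_real_derivative p1 s) (at s)"
    and deriv_p1: "\<And>s. s \<in> I \<Longrightarrow> (p1 has_real_derivative p2 s) (at s)"
    and deriv_q: "\<And>s. s \<in> I \<Longrightarrow> (q has_real_derivative q1 s) (at s)"
    and deriv_q1: "\<And>s. s \<in> I \<Longrightarrow> (q1 has_real_derivative q2 s) (at s)"
    and smooth_gF: "smooth_on V gF"
    and invertible_gF: "\<And>y. y \<in> V \<Longrightarrow> invertible (gF y)"
    and symmetric_gF: "\<And>y. y \<in> V \<Longrightarrow> transpose (gF y) = gF y"
    and metric_eq: "\<And>z. \<alpha> \<bullet> fst_vec z \<in> I \<Longrightarrow> snd_vec z \<in> V \<Longrightarrow>
      G z = block_diag (exp (2 * p (\<alpha> \<bullet> fst_vec z)) *\<^sub>R diag_matrix \<epsilon>)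
                       (exp (2 * q (\<alpha> \<bullet> fst_vec z)) *\<^sub>R gF (snd_vec z))"
begin

abbreviation \<sigma> :: "real^('n + 'd) \<Rightarrow> real" where "\<sigma> z \<equiv> \<alpha> \<bullet> fst_vec z"

definition W :: "(real^('n + 'd)) set" where "W = {z. \<sigma> z \<in> I \<and> snd_vec z \<in> V}"

definition N :: real where "N = (\<Sum>i\<in>UNIV. \<epsilon> i * (\<alpha> $ i)\<^sup>2)"

text \<open>The Christoffel symbols of a conformally flat metric \<open>exp(2p) \<delta>\<close> are \<open>p'\<close> times these constants.\<close>

definition B :: "'n \<Rightarrow> 'n \<Rightarrow> 'n \<Rightarrow> real" where
  "B k i j = (if j = k then \<alpha> $ i else 0) + (if i = k then \<alpha> $ j else 0)
     - (if i = j then \<epsilon> k * \<alpha> $ k * \<epsilon> i else 0)"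

lemma WD: "z \<in> W \<Longrightarrow> \<sigma> z \<in> I" "z \<in> W \<Longrightarrow> snd_vec z \<in> V"
  by (simp_all add: W_def)

lemma sign_square [simp]: "\<epsilon> i * \<epsilon> i = 1" "\<epsilon> i * (\<epsilon> i * x) = x"
  using sign[of i] by auto

lemma bounded_linear_\<sigma>: "bounded_linear \<sigma>"
  by (rule bounded_linear_compose[OF bounded_linear_inner_right bounded_linear_fst_vec])

lemma open_W: "open W"
proof -
  have "W = \<sigma> -` I \<inter> snd_vec -` V" by (auto simp: W_def)
  moreover have "open (\<sigma> -` I)" "open (snd_vec -` V)"
    using open_I open_V bounded_linear_\<sigma> bounded_linear_snd_vec
    by (auto intro!: open_vimage linear_continuous_on)
  ultimately show ?thesis by auto
qed

lemma has_derivative_\<sigma>: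
  assumes "(H has_real_derivative H') (at (\<sigma> z))"
  shows "((\<lambda>z. H (\<sigma> z)) has_derivative (\<lambda>w. H' * \<sigma> w)) (at z)"
  using has_derivative_compose[OF bounded_linear_imp_has_derivative[OF bounded_linear_\<sigma>]
    assms[unfolded has_field_derivative_def]] .

lemma has_derivative_snd_vec:
  assumes "K differentiable (at (snd_vec z))"
  shows "((\<lambda>z. K (snd_vec z)) has_derivative
           (\<lambda>w. frechet_derivative K (at (snd_vec z)) (snd_vec w))) (at z)"
  using has_derivative_compose[OF bounded_linear_imp_has_derivative[OF bounded_linear_snd_vec]
    assms[unfolded frechet_derivative_works]] .

text \<open>All components of the metric and of its connection are products of a function of \<open>\<xi>\<close> and a
  function of the fibre coordinates; this lemma is the only derivative rule they require.\<close>

lemma partial_product: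
  assumes "(H has_real_derivative H') (at (\<sigma> z))" "K differentiable (at (snd_vec z))"
  shows "partial (Inl i) (\<lambda>z. H (\<sigma> z) * K (snd_vec z)) z = \<alpha> $ i * H' * K (snd_vec z)"
    and "partial (Inr a) (\<lambda>z. H (\<sigma> z) * K (snd_vec z)) z = H (\<sigma> z) * partial a K (snd_vec z)"
proof -
  note D = has_derivative_mult[OF has_derivative_\<sigma>[OF assms(1)] has_derivative_snd_vec[OF assms(2)]]
  have "frechet_derivative K (at (snd_vec z)) 0 = 0"
    using assms(2) by (intro linear_0 linear_frechet_derivative)
  then show "partial (Inl i) (\<lambda>z. H (\<sigma> z) * K (snd_vec z)) z = \<alpha> $ i * H' * K (snd_vec z)"
    "partial (Inr a) (\<lambda>z. H (\<sigma> z) * K (snd_vec z)) z = H (\<sigma> z) * partial a K (snd_vec z)"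
    unfolding partial_eq[OF D] by (simp_all add: inner_axis partial_def)
qed

lemma partial_of_\<sigma>:
  assumes "(H has_real_derivative H') (at (\<sigma> z))"
  shows "partial (Inl i) (\<lambda>z. H (\<sigma> z) * c) z = \<alpha> $ i * H' * c"
    and "partial (Inr a) (\<lambda>z. H (\<sigma> z) * c) z = 0"
  using partial_product[OF assms, of "\<lambda>_. c"] by simp_all

lemma partial_of_snd_vec:
  fixes z :: "real^('n + 'd)"
  assumes "K differentiable (at (snd_vec z))"
  shows "partial (Inr a) (\<lambda>z. K (snd_vec z)) z = partial a K (snd_vec z)"
  using partial_product(2)[of "\<lambda>_. 1" 0, OF _ assms] by simp

lemma partial_cong_W:
  "z \<in> W \<Longrightarrow> (\<And>y. y \<in> W \<Longrightarrow> u y = v y) \<Longrightarrow> partial r u z = partial r v z"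
  using open_W partial_cong_open by blast

lemma metric_entries:
  assumes "z \<in> W"
  shows "G z $ Inl i $ Inl j = exp (2 * p (\<sigma> z)) * (if i = j then \<epsilon> i else 0)"
    "G z $ Inr a $ Inr b = exp (2 * q (\<sigma> z)) * gF (snd_vec z) $ a $ b"
    "G z $ Inl i $ Inr b = 0" "G z $ Inr a $ Inl j = 0"
  using assms by (simp_all add: metric_eq W_def diag_matrix_def)

lemma inverse_metric_entries:
  assumes "z \<in> W"
  shows "matrix_inv (G z) $ Inl i $ Inl j = exp (- 2 * p (\<sigma> z)) * (if i = j then \<epsilon> i else 0)"
    "matrix_inv (G z) $ Inr a $ Inr b = exp (- 2 * q (\<sigma> z)) * matrix_inv (gF (snd_vec z)) $ a $ b"
    "matrix_inv (G z) $ Inl i $ Inr b = 0" "matrix_inv (G z) $ Inr a $ Inl j = 0"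
proof -
  have "matrix_inv (G z) = block_diag (exp (- 2 * p (\<sigma> z)) *\<^sub>R diag_matrix \<epsilon>)
      (exp (- 2 * q (\<sigma> z)) *\<^sub>R matrix_inv (gF (snd_vec z)))"
  proof (rule matrix_inv_eqI)
    have "exp (- 2 * p (\<sigma> z)) * exp (2 * p (\<sigma> z)) = 1" "exp (- 2 * q (\<sigma> z)) * exp (2 * q (\<sigma> z)) = 1"
      by (simp_all flip: exp_add)
    then show "G z ** block_diag (exp (- 2 * p (\<sigma> z)) *\<^sub>R diag_matrix \<epsilon>)
      (exp (- 2 * q (\<sigma> z)) *\<^sub>R matrix_inv (gF (snd_vec z))) = mat 1"
      using assms by (simp add: metric_eq W_def block_diag_mult matrix_scaleR_mult
          diag_matrix_sign_square[OF sign] matrix_inv_invertible[OF invertible_gF] block_diag_mat)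
  qed
  then show "matrix_inv (G z) $ Inl i $ Inl j = exp (- 2 * p (\<sigma> z)) * (if i = j then \<epsilon> i else 0)"
    "matrix_inv (G z) $ Inr a $ Inr b = exp (- 2 * q (\<sigma> z)) * matrix_inv (gF (snd_vec z)) $ a $ b"
    "matrix_inv (G z) $ Inl i $ Inr b = 0" "matrix_inv (G z) $ Inr a $ Inl j = 0"
    by (simp_all add: diag_matrix_def)
qed

lemma gF_entry_differentiable:
  assumes "z \<in> W" shows "(\<lambda>y. gF y $ a $ b) differentiable (at (snd_vec z))"
  using smooth_on_imp_differentiable[OF smooth_on_matrix_entry[OF open_V smooth_gF] WD(2)[OF assms]] .

lemma partial_metric_entries:
  assumes z: "z \<in> W"
  shows "partial (Inl m) (\<lambda>z. G z $ Inl i $ Inl j) z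
      = 2 * p1 (\<sigma> z) * \<alpha> $ m * exp (2 * p (\<sigma> z)) * (if i = j then \<epsilon> i else 0)"
    "partial (Inr c) (\<lambda>z. G z $ Inl i $ Inl j) z = 0"
    "partial (Inl m) (\<lambda>z. G z $ Inr a $ Inr b) z
      = 2 * q1 (\<sigma> z) * \<alpha> $ m * exp (2 * q (\<sigma> z)) * gF (snd_vec z) $ a $ b"
    "partial (Inr c) (\<lambda>z. G z $ Inr a $ Inr b) z
      = exp (2 * q (\<sigma> z)) * partial c (\<lambda>y. gF y $ a $ b) (snd_vec z)"
    "partial r (\<lambda>z. G z $ Inl i $ Inr b) z = 0"
    "partial r (\<lambda>z. G z $ Inr a $ Inl j) z = 0"
proof -
  have dp: "((\<lambda>s. exp (2 * p s)) has_real_derivative exp (2 * p (\<sigma> z)) * (2 * p1 (\<sigma> z))) (at (\<sigma> z))"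
    by (auto intro!: derivative_eq_intros deriv_p WD z)
  have dq: "((\<lambda>s. exp (2 * q s)) has_real_derivative exp (2 * q (\<sigma> z)) * (2 * q1 (\<sigma> z))) (at (\<sigma> z))"
    by (auto intro!: derivative_eq_intros deriv_q WD z)
  have *: "partial r (\<lambda>z. G z $ Inl i $ Inl j) z
      = partial r (\<lambda>z. exp (2 * p (\<sigma> z)) * (if i = j then \<epsilon> i else 0)) z" for r
    by (rule partial_cong_W[OF z]) (simp only: metric_entries)
  show "partial (Inl m) (\<lambda>z. G z $ Inl i $ Inl j) z
      = 2 * p1 (\<sigma> z) * \<alpha> $ m * exp (2 * p (\<sigma> z)) * (if i = j then \<epsilon> i else 0)"
    "partial (Inr c) (\<lambda>z. G z $ Inl i $ Inl j) z = 0"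
    unfolding * partial_of_\<sigma>[OF dp] by simp_all
  have *: "partial r (\<lambda>z. G z $ Inr a $ Inr b) z
      = partial r (\<lambda>z. exp (2 * q (\<sigma> z)) * gF (snd_vec z) $ a $ b) z" for r
    by (rule partial_cong_W[OF z]) (simp only: metric_entries)
  show "partial (Inl m) (\<lambda>z. G z $ Inr a $ Inr b) z
      = 2 * q1 (\<sigma> z) * \<alpha> $ m * exp (2 * q (\<sigma> z)) * gF (snd_vec z) $ a $ b"
    "partial (Inr c) (\<lambda>z. G z $ Inr a $ Inr b) z
      = exp (2 * q (\<sigma> z)) * partial c (\<lambda>y. gF y $ a $ b) (snd_vec z)"
    unfolding * partial_product[OF dq gF_entry_differentiable[OF z]] by simp_all
  show "partial r (\<lambda>z. G z $ Inl i $ Inr b) z = 0" "partial r (\<lambda>z. G z $ Inr a $ Inl j) z = 0"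
    using partial_cong_W[OF z, where v = "\<lambda>_. 0"] by (simp_all add: metric_entries)
qed

lemma gF_symmetric:
  assumes "z \<in> W" shows "gF (snd_vec z) $ a $ b = gF (snd_vec z) $ b $ a"
  using arg_cong[OF symmetric_gF[OF WD(2)[OF assms]], of "\<lambda>A. A $ b $ a"]
  by (simp add: transpose_def)

lemma inverse_gF_gF:
  assumes "z \<in> W"
  shows "(\<Sum>c\<in>UNIV. matrix_inv (gF (snd_vec z)) $ a $ c * gF (snd_vec z) $ b $ c) = (if a = b then 1 else 0)"
proof -
  have "(matrix_inv (gF (snd_vec z)) ** gF (snd_vec z)) $ a $ b = mat 1 $ a $ b"
    using matrix_inv_invertible(2)[OF invertible_gF[OF WD(2)[OF assms]]] by simp
  then have "(\<Sum>c\<in>UNIV. matrix_inv (gF (snd_vec z)) $ a $ c * gF (snd_vec z) $ c $ b) = (if a = b then 1 else 0)"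
    by (simp add: matrix_matrix_mult_def mat_def)
  moreover have "(\<Sum>c\<in>UNIV. matrix_inv (gF (snd_vec z)) $ a $ c * gF (snd_vec z) $ b $ c)
      = (\<Sum>c\<in>UNIV. matrix_inv (gF (snd_vec z)) $ a $ c * gF (snd_vec z) $ c $ b)"
    by (intro sum.cong refl arg_cong2[where f = times] gF_symmetric[OF assms])
  ultimately show ?thesis by simp
qed

text \<open>The base block of the inverse metric is diagonal, so that the sum over the raised index has a
  single term.\<close>

lemma christoffel_Inl:
  assumes "z \<in> W"
  shows "christoffel G (Inl k) r s z = 1/2 * (exp (- 2 * p (\<sigma> z)) * \<epsilon> k *
    (partial r (\<lambda>y. G y $ s $ Inl k) z + partial s (\<lambda>y. G y $ r $ Inl k) z
      - partial (Inl k) (\<lambda>y. G y $ r $ s) z))"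
  unfolding christoffel_def sum_UNIV_sum inverse_metric_entries[OF assms]
  by (simp only: mult.assoc mult_delta_left mult_delta_right mult_zero_left sum.neutral_const
      sum.delta sum.delta' finite UNIV_I if_True add_0_right mult_zero_right)

lemma christoffel_base:
  assumes "z \<in> W"
  shows "christoffel G (Inl k) (Inl i) (Inl j) z = p1 (\<sigma> z) * B k i j"
proof -
  have e: "exp (- 2 * p (\<sigma> z)) * exp (2 * p (\<sigma> z)) = 1" by (simp flip: exp_add)
  have "christoffel G (Inl k) (Inl i) (Inl j) z =
    (exp (- 2 * p (\<sigma> z)) * exp (2 * p (\<sigma> z))) * (\<epsilon> k * p1 (\<sigma> z) * (\<alpha> $ i * (if j = k then \<epsilon> j else 0)
      + \<alpha> $ j * (if i = k then \<epsilon> i else 0) - \<alpha> $ k * (if i = j then \<epsilon> i else 0)))"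
    unfolding christoffel_Inl[OF assms] partial_metric_entries[OF assms] by (simp add: algebra_simps)
  also have "\<dots> = p1 (\<sigma> z) * B k i j"
    unfolding e B_def by (auto simp: algebra_simps)
  finally show ?thesis .
qed

lemma christoffel_mixed:
  assumes "z \<in> W"
  shows "christoffel G (Inr a) (Inl i) (Inl j) z = 0"
    "christoffel G (Inl k) (Inl i) (Inr b) z = 0"
    "christoffel G (Inl k) (Inr b) (Inl i) z = 0"
  unfolding christoffel_def sum_UNIV_sum
  by (simp_all add: inverse_metric_entries[OF assms] partial_metric_entries[OF assms])

text \<open>The fibre block of the metric depends on the base point through the factor \<open>exp(2q)\<close> only. Its
  logarithmic derivative is a multiple of the identity once an index is raised.\<close>

lemma christoffel_fibre_base:
  assumes "z \<in> W"
  shows "christoffel G (Inr a) (Inl i) (Inr b) z = q1 (\<sigma> z) * \<alpha> $ i * (if a = b then 1 else 0)"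
    "christoffel G (Inr a) (Inr b) (Inl i) z = q1 (\<sigma> z) * \<alpha> $ i * (if a = b then 1 else 0)"
proof -
  have e: "exp (- 2 * q (\<sigma> z)) * exp (2 * q (\<sigma> z)) = 1" by (simp flip: exp_add)
  have "1 / 2 * (\<Sum>c\<in>UNIV. exp (- 2 * q (\<sigma> z)) * matrix_inv (gF (snd_vec z)) $ a $ c *
      (2 * q1 (\<sigma> z) * \<alpha> $ i * exp (2 * q (\<sigma> z)) * gF (snd_vec z) $ b $ c))
    = (exp (- 2 * q (\<sigma> z)) * exp (2 * q (\<sigma> z))) * q1 (\<sigma> z) * \<alpha> $ i *
        (\<Sum>c\<in>UNIV. matrix_inv (gF (snd_vec z)) $ a $ c * gF (snd_vec z) $ b $ c)"
    by (simp add: sum_distrib_left mult_ac)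
  also have "\<dots> = q1 (\<sigma> z) * \<alpha> $ i * (if a = b then 1 else 0)"
    unfolding e inverse_gF_gF[OF assms] by simp
  finally show "christoffel G (Inr a) (Inl i) (Inr b) z = q1 (\<sigma> z) * \<alpha> $ i * (if a = b then 1 else 0)"
    "christoffel G (Inr a) (Inr b) (Inl i) z = q1 (\<sigma> z) * \<alpha> $ i * (if a = b then 1 else 0)"
    unfolding christoffel_def sum_UNIV_sum
    by (simp_all add: inverse_metric_entries[OF assms] partial_metric_entries[OF assms])
qed

lemma christoffel_base_fibre:
  assumes "z \<in> W"
  shows "christoffel G (Inl k) (Inr a) (Inr b) z
    = (q1 (\<sigma> z) * exp (2 * q (\<sigma> z) - 2 * p (\<sigma> z)) * (- \<epsilon> k * \<alpha> $ k)) * gF (snd_vec z) $ a $ b"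
  unfolding christoffel_Inl[OF assms] partial_metric_entries[OF assms]
  by (simp add: exp_diff exp_minus field_simps)

text \<open>The factor \<open>exp(2q)\<close> is constant along the fibre and cancels against that of the inverse.\<close>

lemma christoffel_fibre:
  assumes "z \<in> W"
  shows "christoffel G (Inr a) (Inr b) (Inr c) z = christoffel gF a b c (snd_vec z)"
proof -
  have e: "exp (- (2 * q (\<sigma> z))) * (x * (exp (2 * q (\<sigma> z)) * y)) = x * y" for x y
    by (simp add: exp_minus)
  show ?thesis
  unfolding christoffel_def sum_UNIV_sum
  by (simp add: inverse_metric_entries[OF assms] partial_metric_entries[OF assms] e mult.assoc
      flip: distrib_left right_diff_distrib)
qed

lemmas christoffel_simps = christoffel_base christoffel_mixed christoffel_fibre_base
  christoffel_base_fibre christoffel_fibre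

lemma partial_christoffel_base:
  assumes z: "z \<in> W"
  shows "partial (Inl m) (christoffel G (Inl k) (Inl i) (Inl j)) z = p2 (\<sigma> z) * \<alpha> $ m * B k i j"
proof -
  have "partial (Inl m) (christoffel G (Inl k) (Inl i) (Inl j)) z
      = partial (Inl m) (\<lambda>z. p1 (\<sigma> z) * B k i j) z"
    by (rule partial_cong_W[OF z]) (rule christoffel_base)
  then show ?thesis using partial_of_\<sigma>(1)[OF deriv_p1[OF WD(1)[OF z]]] by simp
qed

lemma partial_christoffel_fibre_base:
  assumes z: "z \<in> W"
  shows "partial (Inl m) (christoffel G (Inr a) (Inl i) (Inr b)) z
    = q2 (\<sigma> z) * \<alpha> $ m * \<alpha> $ i * (if a = b then 1 else 0)"
proof -
  have "partial (Inl m) (christoffel G (Inr a) (Inl i) (Inr b)) z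
      = partial (Inl m) (\<lambda>z. q1 (\<sigma> z) * (\<alpha> $ i * (if a = b then 1 else 0))) z"
    by (rule partial_cong_W[OF z]) (simp add: christoffel_fibre_base)
  then show ?thesis using partial_of_\<sigma>(1)[OF deriv_q1[OF WD(1)[OF z]]] by simp
qed

lemma partial_christoffel_mixed:
  assumes z: "z \<in> W"
  shows "partial r (christoffel G (Inr a) (Inl i) (Inl j)) z = 0"
    "partial r (christoffel G (Inl k) (Inr b) (Inl i)) z = 0"
  using partial_cong_W[OF z, where v = "\<lambda>_. 0"] by (simp_all add: christoffel_mixed)

lemma partial_christoffel_base_fibre:
  assumes z: "z \<in> W"
  shows "partial (Inl m) (christoffel G (Inl k) (Inr a) (Inr b)) z
    = - \<epsilon> k * \<alpha> $ k * \<alpha> $ m * (q2 (\<sigma> z) + 2 * q1 (\<sigma> z) * (q1 (\<sigma> z) - p1 (\<sigma> z)))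
      * exp (2 * q (\<sigma> z) - 2 * p (\<sigma> z)) * gF (snd_vec z) $ a $ b"
proof -
  have d: "((\<lambda>s. q1 s * exp (2 * q s - 2 * p s) * (- \<epsilon> k * \<alpha> $ k)) has_real_derivative
    - \<epsilon> k * \<alpha> $ k * (q2 (\<sigma> z) + 2 * q1 (\<sigma> z) * (q1 (\<sigma> z) - p1 (\<sigma> z)))
      * exp (2 * q (\<sigma> z) - 2 * p (\<sigma> z))) (at (\<sigma> z))"
    by (auto intro!: derivative_eq_intros deriv_q1 deriv_q deriv_p WD z simp: algebra_simps)
  have "partial (Inl m) (christoffel G (Inl k) (Inr a) (Inr b)) z
    = partial (Inl m) (\<lambda>z. (q1 (\<sigma> z) * exp (2 * q (\<sigma> z) - 2 * p (\<sigma> z)) * (- \<epsilon> k * \<alpha> $ k))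
        * gF (snd_vec z) $ a $ b) z"
    by (rule partial_cong_W[OF z]) (rule christoffel_base_fibre)
  then show ?thesis
    using partial_product(1)[OF d gF_entry_differentiable[OF z]] by (simp add: mult_ac)
qed

lemma partial_christoffel_fibre:
  assumes z: "z \<in> W"
  shows "partial (Inr m) (christoffel G (Inr a) (Inr b) (Inr c)) z
    = partial m (christoffel gF a b c) (snd_vec z)"
proof -
  have "partial (Inr m) (christoffel G (Inr a) (Inr b) (Inr c)) z
    = partial (Inr m) (\<lambda>z. christoffel gF a b c (snd_vec z)) z"
    by (rule partial_cong_W[OF z]) (rule christoffel_fibre)
  then show ?thesis
    using partial_of_snd_vec differentiable_christoffel[OF open_V WD(2)[OF z] smooth_gF invertible_gF]
    by simp
qed

lemmas partial_christoffel_simps = partial_christoffel_base partial_christoffel_mixed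
  partial_christoffel_fibre_base partial_christoffel_base_fibre partial_christoffel_fibre

lemma B_contract [simp]: "B l i l = \<alpha> $ i" "B l l i = \<alpha> $ i"
  by (auto simp: B_def)

text \<open>The two contractions of the constants \<open>B\<close> that occur in the Ricci tensor of the base directions:
  the linear one from the divergence and the trace of the connection, the quadratic one from the
  product of two connection matrices.\<close>

lemma sum_\<alpha>_B: "(\<Sum>l\<in>UNIV. \<alpha> $ l * B l i i) = 2 * (\<alpha> $ i)\<^sup>2 - \<epsilon> i * N"
proof -
  have "(\<Sum>l\<in>UNIV. \<alpha> $ l * B l i i) =
    (\<Sum>l\<in>UNIV. (if i = l then 2 * (\<alpha> $ i)\<^sup>2 else 0) - \<epsilon> i * (\<epsilon> l * (\<alpha> $ l)\<^sup>2))"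
    by (rule sum.cong) (auto simp: B_def power2_eq_square algebra_simps)
  then show ?thesis by (simp add: sum_subtractf N_def sum_distrib_left)
qed

end

text \<open>With the sums interchanged, the Ricci tensor involves the connection through its divergence, its
  trace \<open>\<Sum>\<^sub>l \<Gamma>\<^sup>l\<^sub>l\<^sub>m\<close> and one quadratic contraction, each of which is computed separately.\<close>

lemma ricci_trace_form:
  "ricci G i k x = (\<Sum>l\<in>UNIV. partial l (christoffel G l i k) x)
     - (\<Sum>l\<in>UNIV. partial k (christoffel G l i l) x)
     + (\<Sum>m\<in>UNIV. (\<Sum>l\<in>UNIV. christoffel G l l m x) * christoffel G m i k x)
     - (\<Sum>l\<in>UNIV. \<Sum>m\<in>UNIV. christoffel G l k m x * christoffel G m i l x)"
proof -
  have "(\<Sum>l\<in>UNIV. \<Sum>m\<in>UNIV. christoffel G l l m x * christoffel G m i k x)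
      = (\<Sum>m\<in>UNIV. (\<Sum>l\<in>UNIV. christoffel G l l m x) * christoffel G m i k x)"
    unfolding sum_distrib_right by (rule sum.swap)
  then show ?thesis
    by (simp add: ricci_def riemann_def sum.distrib sum_subtractf)
qed

context warped_coordinates begin

lemma sum_B_B:
  "(\<Sum>l\<in>UNIV. \<Sum>m\<in>UNIV. B l i m * B m i l)
     = (real CARD('n) + 2) * (\<alpha> $ i)\<^sup>2 - 2 * \<epsilon> i * N"
proof -
  have inner: "(\<Sum>m\<in>UNIV. B l i m * B m i l) =
     (\<alpha> $ i)\<^sup>2 + (if i = l then 2 * (\<alpha> $ i)\<^sup>2 - \<epsilon> i * N else 0)
     - \<epsilon> i * (\<epsilon> l * (\<alpha> $ l)\<^sup>2)" for l
  proof -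
    \<comment> \<open>the nine products of Kronecker symbols, sorted by the coincidences \<open>l = m\<close>, \<open>i = l\<close> and \<open>i = m\<close>\<close>
    have "(\<Sum>m\<in>UNIV. B l i m * B m i l) = (\<Sum>m\<in>UNIV. (if l = m then (\<alpha> $ i)\<^sup>2 else 0)
        + (if i = l then (if i = m then 2 * (\<alpha> $ i)\<^sup>2 else 0) - \<epsilon> i * (\<epsilon> m * (\<alpha> $ m)\<^sup>2) else 0)
        - (if i = m then \<epsilon> i * (\<epsilon> l * (\<alpha> $ l)\<^sup>2) else 0))"
      by (rule sum.cong) (auto simp: B_def power2_eq_square algebra_simps)
    also have "\<dots> = (\<alpha> $ i)\<^sup>2 + (if i = l then 2 * (\<alpha> $ i)\<^sup>2 - \<epsilon> i * N else 0)
        - \<epsilon> i * (\<epsilon> l * (\<alpha> $ l)\<^sup>2)"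
      by (simp add: sum.distrib sum_subtractf N_def flip: sum_distrib_left)
    finally show ?thesis .
  qed
  show ?thesis
    unfolding inner by (simp add: sum.distrib sum_subtractf N_def flip: sum_distrib_left)
      (simp add: algebra_simps)
qed

lemma christoffel_trace:
  assumes z: "z \<in> W"
  shows "(\<Sum>l\<in>UNIV. christoffel G l l (Inl i) z)
      = (real CARD('n) * p1 (\<sigma> z) + real CARD('d) * q1 (\<sigma> z)) * \<alpha> $ i"
    and "(\<Sum>l\<in>UNIV. christoffel G l l (Inr a) z) = (\<Sum>c\<in>UNIV. christoffel gF c c a (snd_vec z))"
  by (simp_all add: sum_UNIV_sum christoffel_simps[OF z] algebra_simps)

text \<open>The diagonal entries suffice, since the base block of the inverse metric is diagonal. Along the
  base the fibre enters through the \<open>d\<close> equal entries of the mixed symbols only.\<close>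

lemma ricci_base:
  assumes z: "z \<in> W"
  shows "ricci G (Inl i) (Inl i) z =
    p2 (\<sigma> z) * (2 * (\<alpha> $ i)\<^sup>2 - \<epsilon> i * N)
    - (real CARD('n) * p2 (\<sigma> z) + real CARD('d) * q2 (\<sigma> z)) * (\<alpha> $ i)\<^sup>2
    + (real CARD('n) * p1 (\<sigma> z) + real CARD('d) * q1 (\<sigma> z)) * p1 (\<sigma> z) * (2 * (\<alpha> $ i)\<^sup>2 - \<epsilon> i * N)
    - ((p1 (\<sigma> z))\<^sup>2 * ((real CARD('n) + 2) * (\<alpha> $ i)\<^sup>2 - 2 * \<epsilon> i * N)
       + real CARD('d) * (q1 (\<sigma> z))\<^sup>2 * (\<alpha> $ i)\<^sup>2)"
proof -
  have "(\<Sum>l\<in>UNIV. partial l (christoffel G l (Inl i) (Inl i)) z)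
      = (\<Sum>l\<in>UNIV. p2 (\<sigma> z) * (\<alpha> $ l * B l i i))"
    by (simp add: sum_UNIV_sum partial_christoffel_simps[OF z] mult.assoc)
  then have t1: "(\<Sum>l\<in>UNIV. partial l (christoffel G l (Inl i) (Inl i)) z)
      = p2 (\<sigma> z) * (2 * (\<alpha> $ i)\<^sup>2 - \<epsilon> i * N)"
    by (simp only: sum_\<alpha>_B flip: sum_distrib_left)
  have t2: "(\<Sum>l\<in>UNIV. partial (Inl i) (christoffel G l (Inl i) l) z)
      = (real CARD('n) * p2 (\<sigma> z) + real CARD('d) * q2 (\<sigma> z)) * (\<alpha> $ i)\<^sup>2"
    by (simp add: sum_UNIV_sum partial_christoffel_simps[OF z] power2_eq_square algebra_simps)
  have "(\<Sum>m\<in>UNIV. (\<Sum>l\<in>UNIV. christoffel G l l m z) * christoffel G m (Inl i) (Inl i) z)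
      = (\<Sum>m\<in>UNIV. (real CARD('n) * p1 (\<sigma> z) + real CARD('d) * q1 (\<sigma> z)) * p1 (\<sigma> z)
          * (\<alpha> $ m * B m i i))"
    unfolding sum_UNIV_sum[where t = "\<lambda>m. (\<Sum>l\<in>UNIV. christoffel G l l m z) * christoffel G m (Inl i) (Inl i) z"]
      christoffel_trace[OF z]
    by (simp add: christoffel_simps[OF z] mult_ac)
  then have t3: "(\<Sum>m\<in>UNIV. (\<Sum>l\<in>UNIV. christoffel G l l m z) * christoffel G m (Inl i) (Inl i) z)
      = (real CARD('n) * p1 (\<sigma> z) + real CARD('d) * q1 (\<sigma> z)) * p1 (\<sigma> z)
          * (2 * (\<alpha> $ i)\<^sup>2 - \<epsilon> i * N)"
    by (simp only: sum_\<alpha>_B flip: sum_distrib_left)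
  have "(\<Sum>l\<in>UNIV. \<Sum>m\<in>UNIV. christoffel G l (Inl i) m z * christoffel G m (Inl i) l z)
      = (\<Sum>l\<in>UNIV. \<Sum>m\<in>UNIV. (p1 (\<sigma> z))\<^sup>2 * (B l i m * B m i l))
        + (\<Sum>a\<in>(UNIV :: 'd set). \<Sum>b\<in>UNIV. if a = b then (q1 (\<sigma> z))\<^sup>2 * (\<alpha> $ i)\<^sup>2 else 0)"
    unfolding sum_UNIV_sum christoffel_simps[OF z]
    by (intro arg_cong2[where f = plus])
       (auto intro!: sum.cong simp: power2_eq_square mult_ac simp del: sum.delta sum.delta')
  then have t4: "(\<Sum>l\<in>UNIV. \<Sum>m\<in>UNIV. christoffel G l (Inl i) m z * christoffel G m (Inl i) l z)
      = (p1 (\<sigma> z))\<^sup>2 * ((real CARD('n) + 2) * (\<alpha> $ i)\<^sup>2 - 2 * \<epsilon> i * N)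
        + real CARD('d) * (q1 (\<sigma> z))\<^sup>2 * (\<alpha> $ i)\<^sup>2"
    by (simp add: sum_B_B flip: sum_distrib_left)
  show ?thesis unfolding ricci_trace_form t1 t2 t3 t4 by simp
qed

text \<open>Every term of the Ricci tensor of \<open>g\<^sub>F\<close> reappears; the remaining ones contain a symbol with an upper
  base index and two fibre indices, and are therefore multiples of \<open>g\<^sub>F\<close> and, after summation
  over the base, of \<open>N\<close>.\<close>

lemma ricci_fibre:
  assumes z: "z \<in> W"
  shows "ricci G (Inr a) (Inr b) z = ricci gF a b (snd_vec z)
    - N * exp (2 * q (\<sigma> z) - 2 * p (\<sigma> z)) * gF (snd_vec z) $ a $ b *
      (q2 (\<sigma> z) + (real CARD('n) - 2) * p1 (\<sigma> z) * q1 (\<sigma> z) + real CARD('d) * (q1 (\<sigma> z))\<^sup>2)"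
proof -
  define E where "E = exp (2 * q (\<sigma> z) - 2 * p (\<sigma> z)) * gF (snd_vec z) $ a $ b"
  note sum_N = N_def[symmetric] sum_distrib_left[symmetric]
  have "(\<Sum>l\<in>UNIV. partial l (christoffel G l (Inr a) (Inr b)) z)
     = (\<Sum>l\<in>UNIV. - (E * (q2 (\<sigma> z) + 2 * q1 (\<sigma> z) * (q1 (\<sigma> z) - p1 (\<sigma> z)))) * (\<epsilon> l * (\<alpha> $ l)\<^sup>2))
      + (\<Sum>c\<in>UNIV. partial c (christoffel gF c a b) (snd_vec z))"
    unfolding sum_UNIV_sum partial_christoffel_simps[OF z]
    by (intro arg_cong2[where f = plus] sum.cong) (simp_all add: E_def power2_eq_square)
  then have t1: "(\<Sum>l\<in>UNIV. partial l (christoffel G l (Inr a) (Inr b)) z)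
     = - N * E * (q2 (\<sigma> z) + 2 * q1 (\<sigma> z) * (q1 (\<sigma> z) - p1 (\<sigma> z)))
      + (\<Sum>c\<in>UNIV. partial c (christoffel gF c a b) (snd_vec z))"
    unfolding sum_N by (simp only: mult_ac mult_minus_left mult_minus_right)
  have t2: "(\<Sum>l\<in>UNIV. partial (Inr b) (christoffel G l (Inr a) l) z)
     = (\<Sum>c\<in>UNIV. partial b (christoffel gF c a c) (snd_vec z))"
    by (simp add: sum_UNIV_sum partial_christoffel_simps[OF z])
  have "(\<Sum>m\<in>UNIV. (\<Sum>l\<in>UNIV. christoffel G l l m z) * christoffel G m (Inr a) (Inr b) z)
      = (\<Sum>m\<in>UNIV. - (E * (real CARD('n) * p1 (\<sigma> z) + real CARD('d) * q1 (\<sigma> z)) * q1 (\<sigma> z))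
          * (\<epsilon> m * (\<alpha> $ m)\<^sup>2))
        + (\<Sum>m\<in>UNIV. (\<Sum>c\<in>UNIV. christoffel gF c c m (snd_vec z)) * christoffel gF m a b (snd_vec z))"
    unfolding sum_UNIV_sum[where t = "\<lambda>m. (\<Sum>l\<in>UNIV. christoffel G l l m z) * christoffel G m (Inr a) (Inr b) z"]
      christoffel_trace[OF z] christoffel_simps[OF z]
    by (intro arg_cong2[where f = plus] sum.cong) (simp_all add: E_def power2_eq_square)
  then have t3: "(\<Sum>m\<in>UNIV. (\<Sum>l\<in>UNIV. christoffel G l l m z) * christoffel G m (Inr a) (Inr b) z)
      = - N * E * (real CARD('n) * p1 (\<sigma> z) + real CARD('d) * q1 (\<sigma> z)) * q1 (\<sigma> z)
        + (\<Sum>m\<in>UNIV. (\<Sum>c\<in>UNIV. christoffel gF c c m (snd_vec z)) * christoffel gF m a b (snd_vec z))"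
    unfolding sum_N by (simp only: mult_ac mult_minus_left mult_minus_right)
  \<comment> \<open>the mixed terms of the quadratic contraction, one base and one fibre index, in either order\<close>
  have cross1: "(\<Sum>l\<in>UNIV. \<Sum>c\<in>UNIV. christoffel G (Inl l) (Inr b) (Inr c) z * christoffel G (Inr c) (Inr a) (Inl l) z)
      = - N * E * (q1 (\<sigma> z))\<^sup>2"
  proof -
    have "(\<Sum>c\<in>UNIV. christoffel G (Inl l) (Inr b) (Inr c) z * christoffel G (Inr c) (Inr a) (Inl l) z)
        = (\<Sum>c\<in>UNIV. if c = a then - E * (q1 (\<sigma> z))\<^sup>2 * (\<epsilon> l * (\<alpha> $ l)\<^sup>2) else 0)" for l
      unfolding christoffel_simps[OF z]
      by (rule sum.cong) (auto simp: E_def power2_eq_square gF_symmetric[OF z, of b a])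
    then have "(\<Sum>c\<in>UNIV. christoffel G (Inl l) (Inr b) (Inr c) z * christoffel G (Inr c) (Inr a) (Inl l) z)
        = - E * (q1 (\<sigma> z))\<^sup>2 * (\<epsilon> l * (\<alpha> $ l)\<^sup>2)" for l
      by simp
    then show ?thesis unfolding sum_N by (simp only: sum_N) (simp only: mult_ac mult_minus_left mult_minus_right)
  qed
  have cross2: "(\<Sum>c\<in>UNIV. \<Sum>l\<in>UNIV. christoffel G (Inr c) (Inr b) (Inl l) z * christoffel G (Inl l) (Inr a) (Inr c) z)
      = - N * E * (q1 (\<sigma> z))\<^sup>2"
  proof -
    have "(\<Sum>l\<in>UNIV. christoffel G (Inr c) (Inr b) (Inl l) z * christoffel G (Inl l) (Inr a) (Inr c) z)
        = (if c = b then \<Sum>l\<in>UNIV. - E * (q1 (\<sigma> z))\<^sup>2 * (\<epsilon> l * (\<alpha> $ l)\<^sup>2) else 0)" for c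
      unfolding christoffel_simps[OF z]
      by (auto simp: E_def power2_eq_square intro!: sum.cong)
    then show ?thesis unfolding sum_N
      by (simp only: sum.delta finite UNIV_I if_True) (simp only: mult_ac mult_minus_left mult_minus_right)
  qed
  have t4: "(\<Sum>l\<in>UNIV. \<Sum>m\<in>UNIV. christoffel G l (Inr b) m z * christoffel G m (Inr a) l z)
      = - 2 * N * E * (q1 (\<sigma> z))\<^sup>2
       + (\<Sum>c\<in>UNIV. \<Sum>m\<in>UNIV. christoffel gF c b m (snd_vec z) * christoffel gF m a c (snd_vec z))"
    unfolding sum_UNIV_sum sum.distrib cross1 cross2
    by (simp add: christoffel_simps[OF z])
  show ?thesis unfolding ricci_trace_form t1 t2 t3 t4
    by (simp add: E_def algebra_simps power2_eq_square)
qed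

text \<open>The trace of the two blocks of the Ricci tensor. In the fibre block, contraction of \<open>g\<^sub>F\<close> with
  its own inverse contributes the factor \<open>d\<close>, and \<open>exp(-2q) exp(2q-2p) = exp(-2p)\<close> is the factor
  of the base block.\<close>

theorem scalar_curvature_trace:
  assumes z: "z \<in> W"
  shows "(\<Sum>r\<in>UNIV. \<Sum>s\<in>UNIV. matrix_inv (G z) $ r $ s * ricci G r s z)
    = exp (- 2 * q (\<sigma> z)) *
        (\<Sum>a\<in>UNIV. \<Sum>b\<in>UNIV. matrix_inv (gF (snd_vec z)) $ a $ b * ricci gF a b (snd_vec z))
      - N * exp (- 2 * p (\<sigma> z)) *
        (2 * (real CARD('n) - 1) * p2 (\<sigma> z) + 2 * real CARD('d) * q2 (\<sigma> z)
         + (real CARD('n) - 1) * (real CARD('n) - 2) * (p1 (\<sigma> z))\<^sup>2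
         + real CARD('d) * (real CARD('d) + 1) * (q1 (\<sigma> z))\<^sup>2
         + 2 * real CARD('d) * (real CARD('n) - 2) * p1 (\<sigma> z) * q1 (\<sigma> z))"
proof -
  let ?n = "real CARD('n)" and ?d = "real CARD('d)"
  let ?p1 = "p1 (\<sigma> z)" and ?p2 = "p2 (\<sigma> z)" and ?q1 = "q1 (\<sigma> z)" and ?q2 = "q2 (\<sigma> z)"
  let ?g = "gF (snd_vec z)"
  have "(\<Sum>i\<in>UNIV. \<epsilon> i * ricci G (Inl i) (Inl i) z)
     = (\<Sum>i\<in>UNIV. (2 * ?p2 - (?n * ?p2 + ?d * ?q2) + 2 * (?n * ?p1 + ?d * ?q1) * ?p1
            - ?p1\<^sup>2 * (?n + 2) - ?d * ?q1\<^sup>2) * (\<epsilon> i * (\<alpha> $ i)\<^sup>2)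
        - (?p2 + (?n * ?p1 + ?d * ?q1) * ?p1 - 2 * ?p1\<^sup>2) * N)"
    unfolding ricci_base[OF z] by (rule sum.cong) (simp_all add: algebra_simps)
  also have "\<dots> = (2 * ?p2 - (?n * ?p2 + ?d * ?q2) + 2 * (?n * ?p1 + ?d * ?q1) * ?p1
            - ?p1\<^sup>2 * (?n + 2) - ?d * ?q1\<^sup>2) * N
        - ?n * ((?p2 + (?n * ?p1 + ?d * ?q1) * ?p1 - 2 * ?p1\<^sup>2) * N)"
    by (simp add: sum_subtractf N_def flip: sum_distrib_left)
  finally have base: "(\<Sum>i\<in>UNIV. \<epsilon> i * ricci G (Inl i) (Inl i) z)
     = - N * (2 * (?n - 1) * ?p2 + ?d * ?q2 + (?n - 1) * (?n - 2) * ?p1\<^sup>2 + ?d * ?q1\<^sup>2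
              + ?d * (?n - 2) * ?p1 * ?q1)"
    by (simp add: algebra_simps power2_eq_square)
  have trace_g: "(\<Sum>a\<in>UNIV. \<Sum>b\<in>UNIV. matrix_inv ?g $ a $ b * ?g $ a $ b) = ?d"
    by (simp add: inverse_gF_gF[OF z])
  let ?c = "N * exp (2 * q (\<sigma> z) - 2 * p (\<sigma> z)) * (?q2 + (?n - 2) * ?p1 * ?q1 + ?d * ?q1\<^sup>2)"
  have "(\<Sum>a\<in>UNIV. \<Sum>b\<in>UNIV. matrix_inv ?g $ a $ b * ricci G (Inr a) (Inr b) z)
    = (\<Sum>a\<in>UNIV. \<Sum>b\<in>UNIV. matrix_inv ?g $ a $ b * ricci gF a b (snd_vec z)
         - ?c * (matrix_inv ?g $ a $ b * ?g $ a $ b))"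
    unfolding ricci_fibre[OF z] by (intro sum.cong refl) (simp add: algebra_simps)
  also have "\<dots> = (\<Sum>a\<in>UNIV. \<Sum>b\<in>UNIV. matrix_inv ?g $ a $ b * ricci gF a b (snd_vec z)) - ?c * ?d"
    by (simp only: sum_subtractf trace_g flip: sum_distrib_left)
  finally have fibre: "(\<Sum>a\<in>UNIV. \<Sum>b\<in>UNIV. matrix_inv ?g $ a $ b * ricci G (Inr a) (Inr b) z)
    = (\<Sum>a\<in>UNIV. \<Sum>b\<in>UNIV. matrix_inv ?g $ a $ b * ricci gF a b (snd_vec z)) - ?c * ?d" .
  have e: "exp (- 2 * q (\<sigma> z)) * exp (2 * q (\<sigma> z) - 2 * p (\<sigma> z)) = exp (- 2 * p (\<sigma> z))"
    by (simp flip: exp_add)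
  have "(\<Sum>r\<in>UNIV. \<Sum>s\<in>UNIV. matrix_inv (G z) $ r $ s * ricci G r s z)
    = exp (- 2 * p (\<sigma> z)) * (\<Sum>i\<in>UNIV. \<epsilon> i * ricci G (Inl i) (Inl i) z)
      + exp (- 2 * q (\<sigma> z)) * (\<Sum>a\<in>UNIV. \<Sum>b\<in>UNIV. matrix_inv ?g $ a $ b * ricci G (Inr a) (Inr b) z)"
    unfolding sum_UNIV_sum inverse_metric_entries[OF z]
    by (simp add: mult_delta_left mult_delta_right sum_distrib_left mult.assoc)
  also have "\<dots> = exp (- 2 * p (\<sigma> z)) * (\<Sum>i\<in>UNIV. \<epsilon> i * ricci G (Inl i) (Inl i) z)
      + exp (- 2 * q (\<sigma> z)) * (\<Sum>a\<in>UNIV. \<Sum>b\<in>UNIV. matrix_inv ?g $ a $ b * ricci gF a b (snd_vec z))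
      - N * (exp (- 2 * q (\<sigma> z)) * exp (2 * q (\<sigma> z) - 2 * p (\<sigma> z)))
         * (?q2 + (?n - 2) * ?p1 * ?q1 + ?d * ?q1\<^sup>2) * ?d"
    unfolding fibre right_diff_distrib[of "exp (- 2 * q (\<sigma> z))"] add_diff_eq
    by (simp only: mult_ac)
  also have "\<dots> = exp (- 2 * q (\<sigma> z)) * (\<Sum>a\<in>UNIV. \<Sum>b\<in>UNIV. matrix_inv ?g $ a $ b * ricci gF a b (snd_vec z))
      - N * exp (- 2 * p (\<sigma> z)) * (2 * (?n - 1) * ?p2 + 2 * ?d * ?q2 + (?n - 1) * (?n - 2) * ?p1\<^sup>2
          + ?d * (?d + 1) * ?q1\<^sup>2 + 2 * ?d * (?n - 2) * ?p1 * ?q1)"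
    unfolding e base by (simp add: algebra_simps)
  finally show ?thesis .
qed

end

section \<open>Warped products of semi-Riemannian manifolds\<close>

lemma second_countable_prod_topology:
  assumes "second_countable X" "second_countable Y"
  shows "second_countable (prod_topology X Y)"
proof -
  obtain \<B> where \<B>: "countable \<B>" "\<And>V. V \<in> \<B> \<Longrightarrow> openin X V"
    "\<And>U x. openin X U \<and> x \<in> U \<longrightarrow> (\<exists>V\<in>\<B>. x \<in> V \<and> V \<subseteq> U)"
    using assms(1) by (auto simp: second_countable_def)
  obtain \<C> where \<C>: "countable \<C>" "\<And>V. V \<in> \<C> \<Longrightarrow> openin Y V"
    "\<And>U x. openin Y U \<and> x \<in> U \<longrightarrow> (\<exists>V\<in>\<C>. x \<in> V \<and> V \<subseteq> U)"
    using assms(2) by (auto simp: second_countable_def)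
  let ?\<D> = "(\<lambda>(U, V). U \<times> V) ` (\<B> \<times> \<C>)"
  have "\<exists>P\<in>?\<D>. (x, y) \<in> P \<and> P \<subseteq> W" if "openin (prod_topology X Y) W" "(x, y) \<in> W" for W x y
  proof -
    have "\<exists>U V. openin X U \<and> openin Y V \<and> x \<in> U \<and> y \<in> V \<and> U \<times> V \<subseteq> W"
      using that(1)[unfolded openin_prod_topology_alt, rule_format, OF that(2)] .
    then obtain U V where UV: "openin X U" "openin Y V" "x \<in> U" "y \<in> V" "U \<times> V \<subseteq> W"
      by (elim exE conjE)
    obtain U' where U': "U' \<in> \<B>" "x \<in> U'" "U' \<subseteq> U" using \<B>(3) UV(1,3) by blast
    obtain V' where V': "V' \<in> \<C>" "y \<in> V'" "V' \<subseteq> V" using \<C>(3) UV(2,4) by blast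
    have "U' \<times> V' \<in> ?\<D>" using U'(1) V'(1) by auto
    moreover have "(x, y) \<in> U' \<times> V'" using U'(2) V'(2) by simp
    moreover have "U' \<times> V' \<subseteq> W" using UV(5) U'(3) V'(3) by blast
    ultimately show ?thesis by (intro bexI[of _ "U' \<times> V'"] conjI)
  qed
  then have "\<forall>W x. openin (prod_topology X Y) W \<and> x \<in> W \<longrightarrow> (\<exists>P\<in>?\<D>. x \<in> P \<and> P \<subseteq> W)"
    by (simp only: split_paired_All) simp
  moreover have "\<forall>P\<in>?\<D>. openin (prod_topology X Y) P"
    using \<B>(2) \<C>(2) by (auto simp: openin_prod_Times_iff)
  moreover have "countable ?\<D>" using \<B>(1) \<C>(1) by (intro countable_image countable_SIGMA)
  ultimately show ?thesis
    unfolding second_countable_def by (intro exI[of _ ?\<D>] conjI)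
qed

lemma second_countable_euclidean: "second_countable (euclidean :: 'a::second_countable_topology topology)"
proof -
  obtain \<B> :: "'a set set" where \<B>: "countable \<B>" "\<And>C. C \<in> \<B> \<Longrightarrow> open C"
    "\<And>S. open S \<Longrightarrow> \<exists>U. U \<subseteq> \<B> \<and> S = \<Union>U"
    using univ_second_countable by blast
  have "\<exists>V\<in>\<B>. x \<in> V \<and> V \<subseteq> U" if "open U" "x \<in> U" for U x
    using \<B>(3)[OF that(1)] that(2) by blast
  with \<B>(1,2) show ?thesis
    unfolding second_countable_def open_openin[symmetric]
    by (intro exI[of _ \<B>] conjI allI impI ballI) simp_all
qed

text \<open>Images of product charts and of their overlaps have this form.\<close>

definition vec_times :: "(real^'n::finite) set \<Rightarrow> (real^'k::finite) set \<Rightarrow> (real^('n + 'k)) set" where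
  "vec_times S T = {z. fst_vec z \<in> S \<and> snd_vec z \<in> T}"

lemma vec_times_eq_image: "vec_times S T = (\<lambda>(x, y). join_vec x y) ` (S \<times> T)"
  by (auto simp: vec_times_def image_iff) (metis join_vec_fst_vec_snd_vec)

lemma open_vec_times: "open S \<Longrightarrow> open T \<Longrightarrow> open (vec_times S T)"
  unfolding vec_times_def Collect_conj_eq
  by (intro open_Int open_vimage[unfolded vimage_def]
      linear_continuous_on[OF bounded_linear_fst_vec] linear_continuous_on[OF bounded_linear_snd_vec])

lemma homeomorphic_map_join_vec:
  "homeomorphic_map (top_of_set (S \<times> T)) (top_of_set (vec_times S T)) (\<lambda>(x, y). join_vec x y)"
  unfolding homeomorphic_map_maps homeomorphic_maps_def
proof (intro exI[of _ "\<lambda>z. (fst_vec z, snd_vec z)"] conjI)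
  show "continuous_map (top_of_set (S \<times> T)) (top_of_set (vec_times S T)) (\<lambda>(x, y). join_vec x y)"
    using linear_continuous_on[OF bounded_linear_join_vec] by (auto simp: vec_times_def)
  show "continuous_map (top_of_set (vec_times S T)) (top_of_set (S \<times> T)) (\<lambda>z. (fst_vec z, snd_vec z))"
    using linear_continuous_on[OF bounded_linear_fst_vec] linear_continuous_on[OF bounded_linear_snd_vec]
    by (auto simp: vec_times_def intro!: continuous_on_Pair)
qed auto

lemma smooth_on_join_vec:
  assumes "open S" "open T" "smooth_on S u" "smooth_on T v"
  shows "smooth_on (vec_times S T) (\<lambda>z. join_vec (u (fst_vec z)) (v (snd_vec z)))"
proof -
  note S = open_vec_times[OF assms(1,2)]
  have "smooth_on (vec_times S T) (\<lambda>z. join_vec (u (fst_vec z)) 0 + join_vec 0 (v (snd_vec z)))"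
    by (intro smooth_on_add[OF S] smooth_on_bounded_linear_image[OF S bounded_linear_join_vec_left]
        smooth_on_bounded_linear_image[OF S bounded_linear_join_vec_right]
        smooth_on_compose_bounded_linear[OF S bounded_linear_fst_vec _ assms(3)]
        smooth_on_compose_bounded_linear[OF S bounded_linear_snd_vec _ assms(4)])
      (auto simp: vec_times_def)
  then show ?thesis by (simp flip: join_vec_eq_add)
qed

lemma bounded_linear_block_diag_left: "bounded_linear (\<lambda>A. block_diag A 0)"
  and bounded_linear_block_diag_right: "bounded_linear (\<lambda>B. block_diag 0 B)"
  by (auto intro!: linearI simp: vec_eq_iff sum_all_iff simp flip: linear_conv_bounded_linear)

lemma block_diag_eq_add: "block_diag A B = block_diag A 0 + block_diag 0 B"
  by (auto simp: vec_eq_iff sum_all_iff)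

lemma matrix_join_vec:
  assumes "linear D" "linear E"
  shows "matrix (\<lambda>v. join_vec (D (fst_vec v)) (E (snd_vec v))) = block_diag (matrix D) (matrix E)"
  by (auto simp: vec_eq_iff sum_all_iff matrix_def linear_0[OF assms(1)] linear_0[OF assms(2)])

lemma has_derivative_join_vec:
  assumes "(u has_derivative D) (at (fst_vec z))" "(v has_derivative E) (at (snd_vec z))"
  shows "((\<lambda>z. join_vec (u (fst_vec z)) (v (snd_vec z))) has_derivative
           (\<lambda>w. join_vec (D (fst_vec w)) (E (snd_vec w)))) (at z)"
  using bounded_linear.has_derivative[OF bounded_linear_join_vec
      has_derivative_Pair[OF
        has_derivative_compose[OF bounded_linear_imp_has_derivative[OF bounded_linear_fst_vec] assms(1)]
        has_derivative_compose[OF bounded_linear_imp_has_derivative[OF bounded_linear_snd_vec] assms(2)]]]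
  by simp

lemma chart_properties:
  assumes "smooth_manifold M" "i \<in> charts M"
  shows "openin (mtop M) (cdom M i)" "open (cimage M i)"
    "homeomorphic_map (subtopology (mtop M) (cdom M i)) (top_of_set (cimage M i)) (cmap M i)"
    "inj_on (cmap M i) (cdom M i)"
proof -
  show 1: "openin (mtop M) (cdom M i)" and "open (cimage M i)"
    and 2: "homeomorphic_map (subtopology (mtop M) (cdom M i)) (top_of_set (cimage M i)) (cmap M i)"
    using assms unfolding smooth_manifold_def by blast+
  show "inj_on (cmap M i) (cdom M i)"
    using homeomorphic_imp_injective_map[OF 2] openin_subset[OF 1] by (simp add: Int_absorb1)
qed

lemma cinv_cmap: "smooth_manifold M \<Longrightarrow> i \<in> charts M \<Longrightarrow> p \<in> cdom M i \<Longrightarrow> cinv M i (cmap M i p) = p"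
  by (rule inv_into_f_f[OF chart_properties(4)])

lemma open_overlap:
  assumes "smooth_manifold M" "i \<in> charts M" "j \<in> charts M"
  shows "open (cmap M i ` (cdom M i \<inter> cdom M j))"
proof -
  note i = chart_properties[OF assms(1,2)] and j = chart_properties[OF assms(1,3)]
  have "openin (subtopology (mtop M) (cdom M i)) (cdom M i \<inter> cdom M j)"
    using openin_subtopology_Int2[OF j(1)] .
  then have "openin (top_of_set (cimage M i)) (cmap M i ` (cdom M i \<inter> cdom M j))"
    using homeomorphic_map_openness[OF i(3) openin_subset] by simp
  then show ?thesis using i(2) by (simp add: openin_open_eq)
qed

lemma smooth_transition:
  "smooth_manifold M \<Longrightarrow> i \<in> charts M \<Longrightarrow> j \<in> charts M
    \<Longrightarrow> smooth_on (cmap M i ` (cdom M i \<inter> cdom M j)) (transition M i j)"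
  unfolding smooth_manifold_def by blast

lemma warped_product_simps [simp]:
  "mtop (warped_product B w F) = prod_topology (mtop B) (mtop F)"
  "charts (warped_product B w F) = charts B \<times> charts F"
  "cdom (warped_product B w F) (i, j) = cdom B i \<times> cdom F j"
  "cmap (warped_product B w F) (i, j) = (\<lambda>(p, q). join_vec (cmap B i p) (cmap F j q))"
  "metric (warped_product B w F) (i, j) = (\<lambda>z. block_diag (metric B i (fst_vec z))
      ((w (cinv B i (fst_vec z)))\<^sup>2 *\<^sub>R metric F j (snd_vec z)))"
  by (simp_all add: warped_product_def)

lemma image_join_vec_Times:
  "(\<lambda>(p, q). join_vec (f p) (g q)) ` (P \<times> Q) = vec_times (f ` P) (g ` Q)"
  by (auto simp: vec_times_eq_image image_iff)

lemma cinv_warped_product: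
  assumes "smooth_manifold B" "smooth_manifold F" "i \<in> charts B" "j \<in> charts F"
    and "z \<in> vec_times (cimage B i) (cimage F j)"
  shows "cinv (warped_product B w F) (i, j) z = (cinv B i (fst_vec z), cinv F j (snd_vec z))"
proof -
  obtain p q where pq: "p \<in> cdom B i" "q \<in> cdom F j" "z = join_vec (cmap B i p) (cmap F j q)"
    using assms(5) by (auto simp: vec_times_eq_image)
  have "inj_on (\<lambda>(p, q). join_vec (cmap B i p) (cmap F j q)) (cdom B i \<times> cdom F j)"
    using chart_properties(4)[OF assms(1,3)] chart_properties(4)[OF assms(2,4)]
    by (auto simp: inj_on_def)
  from inv_into_f_f[OF this, of "(p, q)"] pq
  show ?thesis using cinv_cmap[OF assms(1,3) pq(1)] cinv_cmap[OF assms(2,4) pq(2)] by simp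
qed

text \<open>Product charts change by the product of the changes of charts. The restriction on \<open>z\<close> is where
  inverse charts are meaningful.\<close>

lemma transition_warped_product:
  assumes "smooth_manifold B" "smooth_manifold F" "i \<in> charts B" "j \<in> charts F"
    and "z \<in> vec_times (cimage B i) (cimage F j)"
  shows "transition (warped_product B w F) (i, j) (i', j') z
    = join_vec (transition B i i' (fst_vec z)) (transition F j j' (snd_vec z))"
  using cinv_warped_product[OF assms, of w] by simp

lemma smooth_manifold_warped_product:
  assumes B: "smooth_manifold B" and F: "smooth_manifold F"
  shows "smooth_manifold (warped_product B w F)"
  unfolding smooth_manifold_def
proof (intro conjI ballI)
  let ?M = "warped_product B w F"
  show "Hausdorff_space (mtop ?M)" "second_countable (mtop ?M)"
    using B F second_countable_prod_topology
    by (auto simp: smooth_manifold_def Hausdorff_space_prod_topology)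
  show "topspace (mtop ?M) = (\<Union>i\<in>charts ?M. cdom ?M i)"
    using B F by (auto simp: smooth_manifold_def)
next
  let ?M = "warped_product B w F"
  fix c assume "c \<in> charts ?M"
  then obtain i j where c: "c = (i, j)" and i: "i \<in> charts B" and j: "j \<in> charts F" by auto
  note Bi = chart_properties[OF B i] and Fj = chart_properties[OF F j]
  show "openin (mtop ?M) (cdom ?M c)" using Bi(1) Fj(1) by (simp add: c openin_prod_Times_iff)
  show "open (cimage ?M c)" using Bi(2) Fj(2) by (simp add: c image_join_vec_Times open_vec_times)
  obtain f g where fg:
    "homeomorphic_maps (subtopology (mtop B) (cdom B i)) (top_of_set (cimage B i)) (cmap B i) f"
    "homeomorphic_maps (subtopology (mtop F) (cdom F j)) (top_of_set (cimage F j)) (cmap F j) g"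
    using Bi(3) Fj(3) unfolding homeomorphic_map_maps by blast
  then have "homeomorphic_map (subtopology (prod_topology (mtop B) (mtop F)) (cdom B i \<times> cdom F j))
      (top_of_set (cimage B i \<times> cimage F j)) (\<lambda>(p, q). (cmap B i p, cmap F j q))"
    unfolding homeomorphic_map_maps subtopology_Times prod_topology_subtopology_eu[symmetric]
    using homeomorphic_maps_prod by blast
  from homeomorphic_map_compose[OF this homeomorphic_map_join_vec]
  show "homeomorphic_map (subtopology (mtop ?M) (cdom ?M c)) (top_of_set (cimage ?M c)) (cmap ?M c)"
    unfolding c warped_product_simps image_join_vec_Times by (simp add: o_def case_prod_unfold)
  fix c' assume "c' \<in> charts ?M"
  then obtain i' j' where c': "c' = (i', j')" and i': "i' \<in> charts B" and j': "j' \<in> charts F" by auto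
  have ov: "cmap ?M c ` (cdom ?M c \<inter> cdom ?M c')
      = vec_times (cmap B i ` (cdom B i \<inter> cdom B i')) (cmap F j ` (cdom F j \<inter> cdom F j'))"
    by (simp add: c c' Times_Int_Times image_join_vec_Times)
  note o = open_overlap[OF B i i'] open_overlap[OF F j j']
  show "smooth_on (cmap ?M c ` (cdom ?M c \<inter> cdom ?M c')) (transition ?M c c')"
    unfolding ov
  proof (rule smooth_on_cong[OF open_vec_times[OF o] _
        smooth_on_join_vec[OF o smooth_transition[OF B i i'] smooth_transition[OF F j j']]])
    fix z assume "z \<in> vec_times (cmap B i ` (cdom B i \<inter> cdom B i')) (cmap F j ` (cdom F j \<inter> cdom F j'))"
    then have "z \<in> vec_times (cimage B i) (cimage F j)" by (auto simp: vec_times_def)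
    then show "join_vec (transition B i i' (fst_vec z)) (transition F j j' (snd_vec z)) = transition ?M c c' z"
      unfolding c c' using transition_warped_product[OF B F i j] by simp
  qed
qed

lemma semi_riemannian_manifoldD:
  assumes "semi_riemannian_manifold M"
  shows "smooth_manifold M"
    and "i \<in> charts M \<Longrightarrow> smooth_on (cimage M i) (metric M i)"
    and "i \<in> charts M \<Longrightarrow> j \<in> charts M \<Longrightarrow> x \<in> cmap M i ` (cdom M i \<inter> cdom M j) \<Longrightarrow>
      metric M i x = transpose (matrix (frechet_derivative (transition M i j) (at x)))
        ** metric M j (transition M i j x) ** matrix (frechet_derivative (transition M i j) (at x))"
    and "i \<in> charts M \<Longrightarrow> x \<in> cimage M i \<Longrightarrow> transpose (metric M i x) = metric M i x"
    and "i \<in> charts M \<Longrightarrow> x \<in> cimage M i \<Longrightarrow> invertible (metric M i x)"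
    and "\<exists>\<nu>. \<forall>i\<in>charts M. \<forall>x\<in>cimage M i. has_index (metric M i x) \<nu>"
proof -
  note h1 = assms[unfolded semi_riemannian_manifold_def Let_def]
  note h2 = conjunct2[OF h1] note h3 = conjunct2[OF h2] note h4 = conjunct2[OF h3]
  show "smooth_manifold M" using conjunct1[OF h1] .
  show "smooth_on (cimage M i) (metric M i)" if "i \<in> charts M"
    using bspec[OF conjunct1[OF h2] that] .
  show "metric M i x = transpose (matrix (frechet_derivative (transition M i j) (at x)))
        ** metric M j (transition M i j x) ** matrix (frechet_derivative (transition M i j) (at x))"
    if "i \<in> charts M" "j \<in> charts M" "x \<in> cmap M i ` (cdom M i \<inter> cdom M j)"
    using bspec[OF bspec[OF bspec[OF conjunct1[OF h3] that(1)] that(2)] that(3)] .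
  show "transpose (metric M i x) = metric M i x" "invertible (metric M i x)"
    if "i \<in> charts M" "x \<in> cimage M i"
    using bspec[OF bspec[OF conjunct1[OF h4] that(1)] that(2)] by simp_all
  show "\<exists>\<nu>. \<forall>i\<in>charts M. \<forall>x\<in>cimage M i. has_index (metric M i x) \<nu>"
    using conjunct2[OF h4] .
qed

text \<open>The Jacobian of a change of product charts is block diagonal, so that the transformation rule
  splits into those of the factors; the warping function is a function on the manifold and does not
  depend on the chart. Positivity of \<open>w\<close> keeps the second block
  invertible and of the same index, whence the index of the product is the sum of both.\<close>

theorem semi_riemannian_warped_product:
  assumes B: "semi_riemannian_manifold B" and F: "semi_riemannian_manifold F"
    and w: "smooth_function B w" "\<And>p. p \<in> topspace (mtop B) \<Longrightarrow> w p > 0"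
  shows "semi_riemannian_manifold (warped_product B w F)"
  unfolding semi_riemannian_manifold_def
proof (intro conjI ballI)
  note BM = semi_riemannian_manifoldD(1)[OF B] and FM = semi_riemannian_manifoldD(1)[OF F]
  let ?M = "warped_product B w F"
  show "smooth_manifold ?M" by (rule smooth_manifold_warped_product[OF BM FM])
  have wpos: "w (cinv B i x) > 0" if "i \<in> charts B" "x \<in> cimage B i" for i x
    using that(2) cinv_cmap[OF BM that(1)] w(2) openin_subset[OF chart_properties(1)[OF BM that(1)]]
    by auto
  obtain \<nu> \<mu> where \<nu>: "\<forall>i\<in>charts B. \<forall>x\<in>cimage B i. has_index (metric B i x) \<nu>"
    and \<mu>: "\<forall>i\<in>charts F. \<forall>x\<in>cimage F i. has_index (metric F i x) \<mu>"
    using semi_riemannian_manifoldD(6)[OF B] semi_riemannian_manifoldD(6)[OF F] by blast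
  have "has_index (metric ?M c z) (\<nu> + \<mu>)" if c0: "c \<in> charts ?M" and z0: "z \<in> cimage ?M c" for c z
  proof -
    obtain i j where c: "c = (i, j)" and i: "i \<in> charts B" and j: "j \<in> charts F" using c0 by auto
    have zi: "fst_vec z \<in> cimage B i" "snd_vec z \<in> cimage F j"
      using z0 unfolding c by (auto simp: image_join_vec_Times vec_times_def)
    show ?thesis unfolding c warped_product_simps
      using bspec[OF bspec[OF \<nu> i] zi(1)] bspec[OF bspec[OF \<mu> j] zi(2)] wpos[OF i zi(1)]
      by (intro has_index_block_diag has_index_scaleR) simp_all
  qed
  then show "\<exists>\<nu>. \<forall>c\<in>charts ?M. \<forall>z\<in>cimage ?M c. has_index (metric ?M c z) \<nu>" by blast
  {
    fix c assume "c \<in> charts ?M"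
    then obtain i j where c: "c = (i, j)" and i: "i \<in> charts B" and j: "j \<in> charts F" by auto
    let ?S = "vec_times (cimage B i) (cimage F j)"
    have im: "cimage ?M c = ?S" by (simp add: c image_join_vec_Times)
    note S = open_vec_times[OF chart_properties(2)[OF BM i] chart_properties(2)[OF FM j]]
    have sub: "fst_vec ` ?S \<subseteq> cimage B i" "snd_vec ` ?S \<subseteq> cimage F j" by (auto simp: vec_times_def)
    have "smooth_on (cimage B i) (\<lambda>x. w (cinv B i x))"
      using w(1) i by (simp add: smooth_function_def o_def)
    note wS = smooth_on_compose_bounded_linear[OF S bounded_linear_fst_vec sub(1) this]
    have "smooth_on ?S (\<lambda>z. (w (cinv B i (fst_vec z)))\<^sup>2 *\<^sub>R metric F j (snd_vec z))"
      unfolding power2_eq_square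
      by (intro smooth_on_bilinear[OF S bounded_bilinear_scaleR] smooth_on_bilinear[OF S bounded_bilinear_mult]
        wS smooth_on_compose_bounded_linear[OF S bounded_linear_snd_vec sub(2)] semi_riemannian_manifoldD(2)[OF F j])
    from smooth_on_add[OF S
        smooth_on_bounded_linear_image[OF S bounded_linear_block_diag_left
          smooth_on_compose_bounded_linear[OF S bounded_linear_fst_vec sub(1) semi_riemannian_manifoldD(2)[OF B i]]]
        smooth_on_bounded_linear_image[OF S bounded_linear_block_diag_right this]]
    show "smooth_on (cimage ?M c) (metric ?M c)"
      unfolding im unfolding c by (simp flip: block_diag_eq_add)
    {
      fix z assume "z \<in> cimage ?M c"
      then have z: "fst_vec z \<in> cimage B i" "snd_vec z \<in> cimage F j"
        unfolding im by (auto simp: vec_times_def)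
      show "transpose (metric ?M c z) = metric ?M c z"
        unfolding c using semi_riemannian_manifoldD(4)[OF B i z(1)] semi_riemannian_manifoldD(4)[OF F j z(2)]
        by (simp add: transpose_block_diag transpose_scaleR)
      show "invertible (metric ?M c z)"
        unfolding c warped_product_simps
        using wpos[OF i z(1)]
        by (intro invertible_block_diag invertible_scaleR semi_riemannian_manifoldD(5)[OF B i z(1)]
            semi_riemannian_manifoldD(5)[OF F j z(2)]) auto
    }
    fix c' assume "c' \<in> charts ?M"
    then obtain i' j' where c': "c' = (i', j')" and i': "i' \<in> charts B" and j': "j' \<in> charts F" by auto
    let ?P = "cmap B i ` (cdom B i \<inter> cdom B i')" and ?Q = "cmap F j ` (cdom F j \<inter> cdom F j')"
    note o = open_overlap[OF BM i i'] open_overlap[OF FM j j']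
    fix z assume "z \<in> cmap ?M c ` (cdom ?M c \<inter> cdom ?M c')"
    then have z: "z \<in> vec_times ?P ?Q"
      by (simp add: c c' Times_Int_Times image_join_vec_Times)
    then have z1: "fst_vec z \<in> ?P" and z2: "snd_vec z \<in> ?Q" by (auto simp: vec_times_def)
    let ?x = "fst_vec z" and ?y = "snd_vec z"
    let ?D = "frechet_derivative (transition B i i') (at ?x)"
    let ?E = "frechet_derivative (transition F j j') (at ?y)"
    have D: "(transition B i i' has_derivative ?D) (at ?x)" "(transition F j j' has_derivative ?E) (at ?y)"
      using smooth_on_imp_differentiable[OF smooth_transition[OF BM i i'] z1]
        smooth_on_imp_differentiable[OF smooth_transition[OF FM j j'] z2]
      unfolding frechet_derivative_works by auto
    have tr: "transition ?M c c' v = join_vec (transition B i i' (fst_vec v)) (transition F j j' (snd_vec v))"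
      if "v \<in> vec_times ?P ?Q" for v
    proof -
      from that have "v \<in> ?S" by (auto simp: vec_times_def)
      then show ?thesis unfolding c c' by (rule transition_warped_product[OF BM FM i j])
    qed
    have "(transition ?M c c' has_derivative (\<lambda>v. join_vec (?D (fst_vec v)) (?E (snd_vec v)))) (at z)"
      by (rule has_derivative_transform_within_open[OF has_derivative_join_vec[OF D] open_vec_times[OF o] z])
         (rule tr[symmetric])
    then have "frechet_derivative (transition ?M c c') (at z)
        = (\<lambda>v. join_vec (?D (fst_vec v)) (?E (snd_vec v)))"
      by (rule frechet_derivative_at[symmetric])
    then have J: "matrix (frechet_derivative (transition ?M c c') (at z)) = block_diag (matrix ?D) (matrix ?E)"
      using matrix_join_vec[OF has_derivative_linear[OF D(1)] has_derivative_linear[OF D(2)]] by simp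
    \<comment> \<open>both charts represent the same point of the base\<close>
    have w_eq: "w (cinv B i' (transition B i i' ?x)) = w (cinv B i ?x)"
    proof -
      from z1 obtain p where p: "p \<in> cdom B i" "p \<in> cdom B i'" "?x = cmap B i p" by blast
      show ?thesis unfolding p(3) by (simp add: cinv_cmap[OF BM i p(1)] cinv_cmap[OF BM i' p(2)])
    qed
    show "let J = matrix (frechet_derivative (transition ?M c c') (at z)) in
        metric ?M c z = transpose J ** metric ?M c' (transition ?M c c' z) ** J"
      unfolding Let_def J transpose_block_diag tr[OF z]
      unfolding c c' warped_product_simps block_diag_mult fst_vec_join_vec snd_vec_join_vec w_eq
        matrix_scaleR_mult semi_riemannian_manifoldD(3)[OF B i i' z1, symmetric]
        semi_riemannian_manifoldD(3)[OF F j j' z2, symmetric] ..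
  }
qed

lemma smooth_function_warped_product:
  assumes B: "smooth_manifold B" and F: "smooth_manifold F" and "smooth_function B u"
  shows "smooth_function (warped_product B w F) (\<lambda>(x, p). u x)"
  unfolding smooth_function_def
proof
  fix c assume "c \<in> charts (warped_product B w F)"
  then obtain i j where c: "c = (i, j)" and i: "i \<in> charts B" and j: "j \<in> charts F" by auto
  let ?S = "vec_times (cimage B i) (cimage F j)"
  have im: "cimage (warped_product B w F) c = ?S" by (simp add: c image_join_vec_Times)
  note S = open_vec_times[OF chart_properties(2)[OF B i] chart_properties(2)[OF F j]]
  have "smooth_on ?S (\<lambda>z. (u \<circ> cinv B i) (fst_vec z))"
    using assms(3) i
    by (intro smooth_on_compose_bounded_linear[OF S bounded_linear_fst_vec, of "cimage B i"])
       (auto simp: smooth_function_def vec_times_def o_def)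
  then show "smooth_on (cimage (warped_product B w F) c)
      ((\<lambda>(x, p). u x) \<circ> cinv (warped_product B w F) c)"
    unfolding im unfolding c
    by (rule smooth_on_cong[OF S, rotated]) (simp only: o_apply cinv_warped_product[OF B F i j] split_conv)
qed

lemma open_submanifold_simps [simp]:
  "mtop (open_submanifold D G) = top_of_set D" "charts (open_submanifold D G) = {()}"
  "cdom (open_submanifold D G) i = D" "cmap (open_submanifold D G) i = (\<lambda>x. x)"
  "metric (open_submanifold D G) i = G"
  by (simp_all add: open_submanifold_def)

lemma inv_into_ident [simp]: "x \<in> D \<Longrightarrow> inv_into D (\<lambda>x. x) x = x"
  using inv_into_f_f[of "\<lambda>x. x" D x] by simp

text \<open>With a single chart the transformation rule concerns the identity only, whose Jacobian is the
  unit matrix.\<close>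

lemma semi_riemannian_open_submanifold:
  fixes G :: "real^'n::finite \<Rightarrow> real^'n^'n"
  assumes D: "open D" and G: "smooth_on D G"
    and "\<And>x. x \<in> D \<Longrightarrow> transpose (G x) = G x" "\<And>x. x \<in> D \<Longrightarrow> invertible (G x)"
    and "\<And>x. x \<in> D \<Longrightarrow> has_index (G x) \<nu>"
  shows "semi_riemannian_manifold (open_submanifold D G)"
proof -
  let ?M = "open_submanifold D G"
  note inv = inv_into_ident[of _ D]
  have fd: "frechet_derivative (inv_into D (\<lambda>x. x)) (at x) = (\<lambda>v. v)" if "x \<in> D" for x
  proof -
    have "((inv_into D (\<lambda>x. x)) has_derivative (\<lambda>v. v)) (at x)"
      using has_derivative_transform_within_open[OF has_derivative_ident D that] inv by metis
    from frechet_derivative_at[OF this] show ?thesis ..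
  qed
  have "matrix (\<lambda>v::real^'n. v) = mat 1" using matrix_id_mat_1 by (simp add: id_def)
  moreover have "smooth_on D (inv_into D (\<lambda>x. x))"
    by (rule smooth_on_cong[OF D _ smooth_on_ident[OF D]]) (simp add: inv)
  moreover have "homeomorphic_map (top_of_set D) (top_of_set D) (\<lambda>x. x)"
    using homeomorphic_map_id by (metis id_def homeomorphic_map_eq)
  ultimately show ?thesis
    using assms
    by (auto simp: semi_riemannian_manifold_def smooth_manifold_def open_submanifold_def o_def inv fd
        Hausdorff_space_subtopology second_countable_subtopology second_countable_euclidean
        transpose_mat subtopology_subtopology)
qed

section \<open>The Riccati equation and its solutions\<close>

text \<open>The logarithmic derivative of \<open>f \<phi> powr (-k)\<close> with \<open>k = (n-2)/(d+1)\<close>, the function \<open>\<zeta>\<close> of the introduction.\<close>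

definition log_slope :: "nat \<Rightarrow> nat \<Rightarrow> (real \<Rightarrow> real) \<Rightarrow> (real \<Rightarrow> real) \<Rightarrow> real \<Rightarrow> real" where
  "log_slope n d \<phi> f s = deriv f s / f s - (real n - 2) / (real d + 1) * (deriv \<phi> s / \<phi> s)"

text \<open>The difference \<open>2/D w\<close> of two solutions obeys the Bernoulli equation \<open>w' = -D z w - w\<^sup>2\<close>, and
  conversely every solution of the latter shifts \<open>z\<close> to a solution: the inhomogeneous term of the
  Riccati equation is not affected.\<close>

lemma riccati_shift:
  fixes D z w z' :: real
  assumes "D \<noteq> 0"
  shows "(z + 2 / D * w)\<^sup>2 + 2 / D * (z' + 2 / D * (- D * z * w - w\<^sup>2)) = z\<^sup>2 + 2 / D * z'"
  using assms by (simp add: field_simps power2_eq_square)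

text \<open>Quotients \<open>M/W\<close> with \<open>W'\<close> proportional to \<open>M\<close> solve Bernoulli equations. It is used with
  \<open>W' = M\<close> (\<open>W\<close> an antiderivative, \<open>c = 1\<close>) and with \<open>W' = -M\<close> (\<open>c = -1\<close>).\<close>

lemma DERIV_quotient_riccati:
  fixes M W :: "real \<Rightarrow> real"
  assumes M: "(M has_real_derivative - D * x * M s) (at s)"
    and W: "(W has_real_derivative c * M s) (at s)" and "W s \<noteq> 0"
  shows "((\<lambda>s. M s / W s) has_real_derivative - D * x * (M s / W s) - c * (M s / W s)\<^sup>2) (at s)"
proof -
  have "(- D * x * M s * W s - M s * (c * M s)) / (W s * W s)
      = - D * x * (M s / W s) - c * (M s / W s)\<^sup>2"
    using assms(3) by (simp add: diff_divide_distrib power2_eq_square)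
  then show ?thesis using DERIV_divide[OF M W assms(3)] by simp
qed

lemma riccati_solution_onI:
  assumes "\<And>s. s \<in> J \<Longrightarrow> (z has_real_derivative z' s) (at s)"
    and "\<And>s. s \<in> J \<Longrightarrow> (z s)\<^sup>2 + 2 / (real d + 1) * z' s
       + (real n + real d - 1) / (real d * (real d + 1)\<^sup>2) *
         (real n * (deriv \<phi> s / \<phi> s)\<^sup>2 - 2 * (deriv (deriv \<phi>) s / \<phi> s)) = 0"
  shows "riccati_solution_on J n d \<phi> z"
  unfolding riccati_solution_on_def
proof
  fix s assume s: "s \<in> J"
  from DERIV_imp_deriv[OF assms(1)[OF s]] assms(2)[OF s] assms(1)[OF s]
  show "z differentiable (at s) \<and> (z s)\<^sup>2 + 2 / (real d + 1) * deriv z s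
       + (real n + real d - 1) / (real d * (real d + 1)\<^sup>2) *
         (real n * (deriv \<phi> s / \<phi> s)\<^sup>2 - 2 * (deriv (deriv \<phi>) s / \<phi> s)) = 0"
    by (auto simp: real_differentiable_def)
qed

lemma riccati_solution_onD:
  assumes "riccati_solution_on J n d \<phi> z" "s \<in> J"
  shows "(z has_real_derivative deriv z s) (at s)"
    and "(z s)\<^sup>2 + 2 / (real d + 1) * deriv z s
       + (real n + real d - 1) / (real d * (real d + 1)\<^sup>2) *
         (real n * (deriv \<phi> s / \<phi> s)\<^sup>2 - 2 * (deriv (deriv \<phi>) s / \<phi> s)) = 0"
  using assms unfolding riccati_solution_on_def
  by (auto simp: real_differentiable_def DERIV_deriv_iff_field_differentiable field_differentiable_def)

lemma DERIV_log_slope: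
  assumes "(f has_real_derivative deriv f s) (at s)" "f s > 0"
    and "(\<phi> has_real_derivative deriv \<phi> s) (at s)" "\<phi> s > 0"
  shows "((\<lambda>s. ln (f s) - (real n - 2) / (real d + 1) * ln (\<phi> s))
    has_real_derivative log_slope n d \<phi> f s) (at s)"
  unfolding log_slope_def using assms
  by (auto intro!: derivative_eq_intros simp: divide_inverse mult_ac)

text \<open>Taking logarithms in the formula for \<open>f\<close> and differentiating shows that \<^const>\<open>log_slope\<close> is the
  particular solution shifted by the logarithmic derivative of the antiderivative \<open>E + c\<close>.\<close>

lemma riccati_representation_imp_riccati:
  assumes J: "open J"
    and \<phi>: "\<And>s. s \<in> J \<Longrightarrow> (\<phi> has_real_derivative deriv \<phi> s) (at s)" "\<And>s. s \<in> J \<Longrightarrow> \<phi> s > 0"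
    and f: "\<And>s. s \<in> J \<Longrightarrow> (f has_real_derivative deriv f s) (at s)" "\<And>s. s \<in> J \<Longrightarrow> f s > 0"
    and rep: "riccati_representation_on J n d \<phi> f"
  shows "riccati_solution_on J n d \<phi> (log_slope n d \<phi> f)"
proof -
  define k where "k = (real n - 2) / (real d + 1)"
  define D where "D = real d + 1"
  have D: "D \<noteq> 0" "D > 0" by (simp_all add: D_def)
  obtain z \<Phi> E C where z: "riccati_solution_on J n d \<phi> z"
    and \<Phi>: "antiderivative_on J z \<Phi>"
    and E: "antiderivative_on J (\<lambda>s. exp (- (real d + 1) * \<Phi> s)) E"
    and eq: "\<forall>s\<in>J. E s + 2 / (real d + 1) * C > 0 \<and>
           f s = \<phi> s powr ((real n - 2) / (real d + 1)) * exp (\<Phi> s) *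
                 (E s + 2 / (real d + 1) * C) powr (2 / (real d + 1))"
    using rep unfolding riccati_representation_on_def by (elim exE conjE)
  define c where "c = 2 / D * C"
  define w where "w = (\<lambda>s. exp (- D * \<Phi> s) / (E s + c))"
  have Ec: "E s + c > 0" if "s \<in> J" for s using eq that by (simp add: c_def D_def)
  have D\<Phi>: "(\<Phi> has_real_derivative z s) (at s)" if "s \<in> J" for s
    using \<Phi> that by (simp add: antiderivative_on_def)
  have DE: "(E has_real_derivative exp (- D * \<Phi> s)) (at s)" if "s \<in> J" for s
    using E that by (simp add: antiderivative_on_def D_def)
  have ln_f: "ln (f s) - k * ln (\<phi> s) = \<Phi> s + 2 / D * ln (E s + c)" if "s \<in> J" for s
  proof -
    have "f s = \<phi> s powr k * exp (\<Phi> s) * (E s + c) powr (2 / D)"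
      using eq that by (simp add: c_def D_def k_def)
    then show ?thesis
      using \<phi>(2)[OF that] Ec[OF that] by (simp add: ln_mult ln_powr)
  qed
  have slope: "log_slope n d \<phi> f s = z s + 2 / D * w s" if s: "s \<in> J" for s
  proof (rule DERIV_unique)
    show "((\<lambda>s. ln (f s) - k * ln (\<phi> s)) has_real_derivative log_slope n d \<phi> f s) (at s)"
      unfolding k_def using DERIV_log_slope f \<phi> s by blast
    have "((\<lambda>s. \<Phi> s + 2 / D * ln (E s + c)) has_real_derivative z s + 2 / D * w s) (at s)"
      unfolding w_def using Ec[OF s] D
      by (auto intro!: derivative_eq_intros D\<Phi>[OF s] DE[OF s] simp: divide_inverse mult_ac)
    then show "((\<lambda>s. ln (f s) - k * ln (\<phi> s)) has_real_derivative z s + 2 / D * w s) (at s)"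
      by (rule has_field_derivative_transform_within_open[OF _ J s]) (simp add: ln_f)
  qed
  have Dw: "(w has_real_derivative - D * z s * w s - (w s)\<^sup>2) (at s)" if s: "s \<in> J" for s
  proof -
    have "((\<lambda>s. exp (- D * \<Phi> s)) has_real_derivative - D * z s * exp (- D * \<Phi> s)) (at s)"
      by (auto intro!: derivative_eq_intros D\<Phi>[OF s])
    moreover have "((\<lambda>s. E s + c) has_real_derivative 1 * exp (- D * \<Phi> s)) (at s)"
      by (auto intro!: derivative_eq_intros DE[OF s])
    ultimately show ?thesis
      using DERIV_quotient_riccati[of "\<lambda>s. exp (- D * \<Phi> s)" D "z s" s "\<lambda>s. E s + c" 1] Ec[OF s]
      by (simp add: w_def)
  qed
  show ?thesis
  proof (rule riccati_solution_onI)
    fix s assume s: "s \<in> J"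
    have "((\<lambda>s. z s + 2 / D * w s) has_real_derivative deriv z s + 2 / D * (- D * z s * w s - (w s)\<^sup>2)) (at s)"
      by (intro DERIV_add DERIV_cmult riccati_solution_onD(1)[OF z s] Dw[OF s])
    then show "(log_slope n d \<phi> f has_real_derivative
        deriv z s + 2 / D * (- D * z s * w s - (w s)\<^sup>2)) (at s)"
      by (rule has_field_derivative_transform_within_open[OF _ J s]) (simp add: slope)
    show "(log_slope n d \<phi> f s)\<^sup>2 + 2 / (real d + 1) * (deriv z s + 2 / D * (- D * z s * w s - (w s)\<^sup>2))
       + (real n + real d - 1) / (real d * (real d + 1)\<^sup>2) *
         (real n * (deriv \<phi> s / \<phi> s)\<^sup>2 - 2 * (deriv (deriv \<phi>) s / \<phi> s)) = 0"
      unfolding slope[OF s] D_def[symmetric] riccati_shift[OF D(1)]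
      using riccati_solution_onD(2)[OF z s] by (simp only: D_def)
  qed
qed

text \<open>The constant \<open>C = 0\<close> suffices, as the constant of integration is absorbed in the choice of the
  particular solution: \<open>W\<close> is a primitive of \<open>-exp(-D l)\<close> made positive by a constant exceeding
  the maximum on the compact interval of the opposite primitive \<open>L\<close>. Then \<open>\<Phi> = l + 2/D ln W\<close> satisfies
  \<open>exp(-D \<Phi>) = exp(-D l) / W\<^sup>2\<close>, which is the derivative of \<open>E = 1/W\<close>, and \<open>exp(\<Phi>) E powr (2/D) = exp(l)\<close> recovers \<open>f\<close>.\<close>

lemma riccati_imp_riccati_representation:
  assumes J: "{a..b} \<subseteq> I" "a < b"
    and \<phi>: "\<And>s. s \<in> I \<Longrightarrow> (\<phi> has_real_derivative deriv \<phi> s) (at s)" "\<And>s. s \<in> I \<Longrightarrow> \<phi> s > 0"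
    and f: "\<And>s. s \<in> I \<Longrightarrow> (f has_real_derivative deriv f s) (at s)" "\<And>s. s \<in> I \<Longrightarrow> f s > 0"
    and ric: "riccati_solution_on {a<..<b} n d \<phi> (log_slope n d \<phi> f)"
  shows "riccati_representation_on {a<..<b} n d \<phi> f"
proof -
  let ?J = "{a<..<b}"
  define k where "k = (real n - 2) / (real d + 1)"
  define D where "D = real d + 1"
  have D: "D \<noteq> 0" "D > 0" by (simp_all add: D_def)
  define \<zeta> where "\<zeta> = log_slope n d \<phi> f"
  define l where "l = (\<lambda>s. ln (f s) - k * ln (\<phi> s))"
  have Dl: "(l has_real_derivative \<zeta> s) (at s)" if "s \<in> I" for s
    unfolding l_def k_def \<zeta>_def using DERIV_log_slope f \<phi> that by blast
  have "continuous_on {a..b} l"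
    using J(1) Dl by (intro continuous_at_imp_continuous_on) (auto intro: DERIV_isCont)
  then have "continuous_on {a..b} (\<lambda>s. exp (- D * l s))" by (intro continuous_intros)
  then obtain L where L: "\<And>s. s \<in> {a..b} \<Longrightarrow>
      (L has_vector_derivative exp (- D * l s)) (at s within {a..b})"
    using antiderivative_continuous by blast
  have "continuous_on {a..b} L" using L
    by (meson continuous_on_eq_continuous_within has_vector_derivative_continuous)
  then obtain m where "\<forall>s\<in>{a..b}. L s \<le> L m"
    using continuous_attains_sup[of "{a..b}" L] J(2) by auto
  define W where "W = (\<lambda>s. L m + 1 - L s)"
  have Wpos: "W s > 0" if "s \<in> ?J" for s
    using bspec[OF \<open>\<forall>s\<in>{a..b}. L s \<le> L m\<close>, of s] that by (simp add: W_def)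
  have DW: "(W has_real_derivative - exp (- D * l s)) (at s)" if s: "s \<in> ?J" for s
  proof -
    have "at s within {a..b} = at s" using s by (intro at_within_Icc_at) auto
    then have "(L has_vector_derivative exp (- D * l s)) (at s)"
      using L[of s] s by simp
    then have "(L has_real_derivative exp (- D * l s)) (at s)"
      by (simp only: has_real_derivative_iff_has_vector_derivative)
    from DERIV_diff[OF DERIV_const[of "L m + 1"] this]
    show ?thesis unfolding W_def by (simp only: diff_0)
  qed
  have JI: "s \<in> I" if "s \<in> ?J" for s using J(1) that by auto
  define y where "y = (\<lambda>s. exp (- D * l s) / W s)"
  define z where "z = (\<lambda>s. \<zeta> s - 2 / D * y s)"
  define \<Phi> where "\<Phi> = (\<lambda>s. l s + 2 / D * ln (W s))"
  have Dy: "(y has_real_derivative - D * z s * y s - (y s)\<^sup>2) (at s)" if s: "s \<in> ?J" for s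
  proof -
    have "((\<lambda>s. exp (- D * l s)) has_real_derivative - D * \<zeta> s * exp (- D * l s)) (at s)"
      by (auto intro!: derivative_eq_intros Dl[OF JI[OF s]])
    moreover have "(W has_real_derivative -1 * exp (- D * l s)) (at s)"
      using DW[OF s] by simp
    ultimately have "(y has_real_derivative - D * \<zeta> s * y s + (y s)\<^sup>2) (at s)"
      using DERIV_quotient_riccati[of "\<lambda>s. exp (- D * l s)" D "\<zeta> s" s W "-1"] Wpos[OF s]
      by (simp add: y_def)
    moreover have "- D * \<zeta> s * y s + (y s)\<^sup>2 = - D * z s * y s - (y s)\<^sup>2"
      using D(1) by (simp add: z_def field_simps power2_eq_square)
    ultimately show ?thesis by (simp only:)
  qed
  have z: "riccati_solution_on ?J n d \<phi> z"
  proof (rule riccati_solution_onI)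
    fix s assume s: "s \<in> ?J"
    let ?z' = "deriv \<zeta> s - 2 / D * (- D * z s * y s - (y s)\<^sup>2)"
    have "((\<lambda>s. \<zeta> s - 2 / D * y s) has_real_derivative ?z') (at s)"
      by (intro DERIV_diff DERIV_cmult Dy[OF s] riccati_solution_onD(1)[OF ric[folded \<zeta>_def] s])
    then show "(z has_real_derivative ?z') (at s)" by (simp only: z_def)
    have "\<zeta> s = z s + 2 / D * y s" by (simp add: z_def)
    then have "(\<zeta> s)\<^sup>2 + 2 / D * deriv \<zeta> s = (z s)\<^sup>2 + 2 / D * ?z'"
      using riccati_shift[OF D(1), of "z s" "y s" ?z'] by simp
    then show "(z s)\<^sup>2 + 2 / (real d + 1) * ?z'
       + (real n + real d - 1) / (real d * (real d + 1)\<^sup>2) *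
         (real n * (deriv \<phi> s / \<phi> s)\<^sup>2 - 2 * (deriv (deriv \<phi>) s / \<phi> s)) = 0"
      using riccati_solution_onD(2)[OF ric s] by (simp only: D_def \<zeta>_def)
  qed
  have D\<Phi>: "antiderivative_on ?J z \<Phi>"
    unfolding antiderivative_on_def
  proof
    fix s assume s: "s \<in> ?J"
    show "(\<Phi> has_real_derivative z s) (at s)"
      unfolding \<Phi>_def z_def y_def using Wpos[OF s] D
      by (auto intro!: derivative_eq_intros Dl[OF JI[OF s]] DW[OF s] simp: divide_inverse mult_ac)
  qed
  have exp_\<Phi>: "exp (- D * \<Phi> s) = exp (- D * l s) / (W s)\<^sup>2" if s: "s \<in> ?J" for s
  proof -
    have "- D * \<Phi> s = - D * l s + - (ln (W s) + ln (W s))" using D(2) by (simp add: \<Phi>_def field_simps)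
    then show ?thesis using Wpos[OF s] by (simp only: exp_add exp_minus exp_ln power2_eq_square divide_inverse inverse_mult_distrib)
  qed
  have DE: "antiderivative_on ?J (\<lambda>s. exp (- (real d + 1) * \<Phi> s)) (\<lambda>s. 1 / W s)"
    unfolding antiderivative_on_def D_def[symmetric]
  proof
    fix s assume s: "s \<in> ?J"
    show "((\<lambda>s. 1 / W s) has_real_derivative exp (- D * \<Phi> s)) (at s)"
      unfolding exp_\<Phi>[OF s] using Wpos[OF s]
      by (auto intro!: derivative_eq_intros DW[OF s] simp: power2_eq_square)
  qed
  have "1 / W s + 2 / (real d + 1) * 0 > 0 \<and>
      f s = \<phi> s powr ((real n - 2) / (real d + 1)) * exp (\<Phi> s) *
            (1 / W s + 2 / (real d + 1) * 0) powr (2 / (real d + 1))" if s: "s \<in> ?J" for s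
  proof -
    have "f s = exp (k * ln (\<phi> s) + l s)" using f(2)[OF JI[OF s]] by (simp add: l_def)
    also have "\<dots> = exp (k * ln (\<phi> s) + \<Phi> s + 2 / D * ln (1 / W s))"
      using Wpos[OF s] by (simp add: \<Phi>_def ln_div)
    also have "\<dots> = \<phi> s powr k * exp (\<Phi> s) * (1 / W s) powr (2 / D)"
      using Wpos[OF s] \<phi>(2)[OF JI[OF s]] by (simp add: exp_add powr_def)
    finally show ?thesis using Wpos[OF s] by (simp add: k_def D_def)
  qed
  with z D\<Phi> DE show ?thesis unfolding riccati_representation_on_def by blast
qed

text \<open>The parameter \<open>A = (n-2)/(d+1)\<close> clears all denominators: \<open>n = A(d+1) + 2\<close> and
  \<open>n + d - 1 = (d+1)(A+1)\<close>, after which both sides are polynomials.\<close>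

lemma conformal_riccati:
  fixes n d p1 p2 q1 q2 :: real
  assumes "d > 0"
  shows "2 * (n - 1) * p2 + 2 * d * q2 + (n - 1) * (n - 2) * p1\<^sup>2 + d * (d + 1) * q1\<^sup>2
      + 2 * d * (n - 2) * p1 * q1
    = d * (d + 1) * ((q1 + (n - 2) / (d + 1) * p1)\<^sup>2 + 2 / (d + 1) * (q2 + (n - 2) / (d + 1) * p2)
        + (n + d - 1) / (d * (d + 1)\<^sup>2) * ((n - 2) * p1\<^sup>2 + 2 * p2))"
proof -
  define A where "A = (n - 2) / (d + 1)"
  have n: "n = A * (d + 1) + 2" using assms by (simp add: A_def)
  then have "n + d - 1 = (d + 1) * (A + 1)" by (simp add: algebra_simps)
  then have B: "(n + d - 1) / (d * (d + 1)\<^sup>2) = (A + 1) / (d * (d + 1))"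
    using assms by (simp add: power2_eq_square)
  have e: "d * (d + 1) * (2 / (d + 1) * X) = 2 * d * X"
    "d * (d + 1) * ((A + 1) / (d * (d + 1)) * X) = (A + 1) * X" for X
    using assms by simp_all
  have "d * (d + 1) * ((q1 + A * p1)\<^sup>2 + 2 / (d + 1) * (q2 + A * p2)
        + (n + d - 1) / (d * (d + 1)\<^sup>2) * ((n - 2) * p1\<^sup>2 + 2 * p2))
     = d * (d + 1) * (q1 + A * p1)\<^sup>2 + 2 * d * (q2 + A * p2) + (A + 1) * ((n - 2) * p1\<^sup>2 + 2 * p2)"
    unfolding B distrib_left[of "d * (d + 1)"] e ..
  also have "\<dots> = 2 * (n - 1) * p2 + 2 * d * q2 + (n - 1) * (n - 2) * p1\<^sup>2 + d * (d + 1) * q1\<^sup>2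
      + 2 * d * (n - 2) * p1 * q1"
    unfolding n by (simp add: algebra_simps power2_eq_square)
  finally show ?thesis by (simp add: A_def)
qed

section \<open>Solitons with constant potential\<close>

lemma hessian_of_constant:
  assumes "smooth_manifold M" "c \<in> charts M" "x \<in> cimage M c"
    and "\<And>y. y \<in> cimage M c \<Longrightarrow> u (cinv M c y) = k"
  shows "hessian M u c x = 0"
proof -
  note op = chart_properties(2)[OF assms(1,2)]
  have d: "partial j (u \<circ> cinv M c) y = 0" if "y \<in> cimage M c" for j y
    using partial_cong_open[OF op that, of "u \<circ> cinv M c" "\<lambda>_. k"] assms(4) by simp
  have "partial i (partial j (u \<circ> cinv M c)) x = 0" for i j
    using partial_cong_open[OF op assms(3), of "partial j (u \<circ> cinv M c)" "\<lambda>_. 0"] d by simp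
  then show ?thesis using d[OF assms(3)] by (simp add: hessian_def Let_def vec_eq_iff)
qed

lemma steady_soliton_of_constant_iff:
  assumes "semi_riemannian_manifold M" "smooth_function M u"
    and "\<And>c y. c \<in> charts M \<Longrightarrow> y \<in> cimage M c \<Longrightarrow> u (cinv M c y) = k"
  shows "steady_gradient_yamabe_soliton M u \<longleftrightarrow> has_constant_scalar_curvature M 0"
proof -
  have "(scalar_curvature M c x - 0) *\<^sub>R metric M c x = hessian M u c x \<longleftrightarrow> scalar_curvature M c x = 0"
    if "c \<in> charts M" "x \<in> cimage M c" for c x
  proof -
    have inv: "metric M c x ** matrix_inv (metric M c x) = mat 1"
      by (intro matrix_inv_invertible semi_riemannian_manifoldD(5)[OF assms(1)] that)
    have "metric M c x \<noteq> 0"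
    proof
      assume "metric M c x = 0"
      then have "mat 1 $ i $ i = (0 :: real)" for i :: 'c
        by (simp add: matrix_matrix_mult_def flip: inv)
      then show False by (simp add: mat_def)
    qed
    moreover have "hessian M u c x = 0"
      using that semi_riemannian_manifoldD(1)[OF assms(1)] assms(3) by (intro hessian_of_constant)
    ultimately show ?thesis by simp
  qed
  then show ?thesis
    using assms(1,2) unfolding gradient_yamabe_soliton_def has_constant_scalar_curvature_def by auto
qed

lemma smooth_function_open_submanifold:
  assumes "open D" "smooth_on D u" shows "smooth_function (open_submanifold D G) u"
  unfolding smooth_function_def
  using smooth_on_cong[OF assms(1) _ assms(2), of "u \<circ> inv_into D (\<lambda>x. x)"] by simp

section \<open>Scalar flatness as a Riccati equation\<close>

text \<open>The two functions of \<open>\<xi>\<close> that determine the metric, in their logarithmic form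
  \<open>\<phi> = exp(-p)\<close>, \<open>f = exp(q)\<close>, with the derivatives of \<open>p\<close> and \<open>q\<close> in terms of those of \<open>\<phi>\<close> and \<open>f\<close>.\<close>

locale warping_profile =
  fixes I :: "real set" and \<phi> f :: "real \<Rightarrow> real"
  assumes open_I: "open I"
    and smooth_\<phi>: "smooth_on I \<phi>" and \<phi>_pos: "\<And>s. s \<in> I \<Longrightarrow> \<phi> s > 0"
    and smooth_f: "smooth_on I f" and f_pos: "\<And>s. s \<in> I \<Longrightarrow> f s > 0"
begin

definition p where "p s = - ln (\<phi> s)"
definition p1 where "p1 s = - (deriv \<phi> s / \<phi> s)"
definition p2 where "p2 s = (deriv \<phi> s / \<phi> s)\<^sup>2 - deriv (deriv \<phi>) s / \<phi> s"
definition q where "q s = ln (f s)"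
definition q1 where "q1 s = deriv f s / f s"
definition q2 where "q2 s = deriv (deriv f) s / f s - (deriv f s / f s)\<^sup>2"

lemma DERIV_log_derivative:
  assumes "smooth_on I u" "u s > 0" "s \<in> I"
  shows "((\<lambda>s. ln (u s)) has_real_derivative deriv u s / u s) (at s)"
    and "((\<lambda>s. deriv u s / u s) has_real_derivative
           deriv (deriv u) s / u s - (deriv u s / u s)\<^sup>2) (at s)"
proof -
  note d = smooth_on_imp_DERIV[OF assms(1,3)]
    smooth_on_imp_DERIV[OF smooth_on_deriv[OF open_I assms(1)] assms(3)]
  show "((\<lambda>s. ln (u s)) has_real_derivative deriv u s / u s) (at s)"
    using assms(2) by (auto intro!: derivative_eq_intros d simp: divide_inverse)
  show "((\<lambda>s. deriv u s / u s) has_real_derivative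
           deriv (deriv u) s / u s - (deriv u s / u s)\<^sup>2) (at s)"
    using DERIV_divide[OF d(2,1)] assms(2) by (simp add: diff_divide_distrib power2_eq_square)
qed

lemma DERIV_profile:
  assumes s: "s \<in> I"
  shows "(p has_real_derivative p1 s) (at s)" "(p1 has_real_derivative p2 s) (at s)"
    "(q has_real_derivative q1 s) (at s)" "(q1 has_real_derivative q2 s) (at s)"
proof -
  note \<phi>' = DERIV_log_derivative[OF smooth_\<phi> \<phi>_pos[OF s] s]
  note f' = DERIV_log_derivative[OF smooth_f f_pos[OF s] s]
  show "(p has_real_derivative p1 s) (at s)"
    using DERIV_minus[OF \<phi>'(1)] by (simp add: p_def[abs_def] p1_def)
  show "(p1 has_real_derivative p2 s) (at s)"
    using DERIV_minus[OF \<phi>'(2)] by (simp add: p1_def[abs_def] p2_def)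
  show "(q has_real_derivative q1 s) (at s)" "(q1 has_real_derivative q2 s) (at s)"
    using f' by (simp_all add: q_def[abs_def] q1_def[abs_def] q2_def)
qed

text \<open>The bracket in the scalar curvature of \<open>exp(2p) \<delta> + exp(2q) g\<^sub>F\<close>.\<close>

definition curvature_factor :: "nat \<Rightarrow> nat \<Rightarrow> real \<Rightarrow> real" where
  "curvature_factor n d s = 2 * (real n - 1) * p2 s + 2 * real d * q2 s
         + (real n - 1) * (real n - 2) * (p1 s)\<^sup>2
         + real d * (real d + 1) * (q1 s)\<^sup>2
         + 2 * real d * (real n - 2) * p1 s * q1 s"

lemma riccati_log_slope_iff:
  assumes "d > 0"
  shows "riccati_solution_on I n d \<phi> (log_slope n d \<phi> f) \<longleftrightarrow> (\<forall>s\<in>I. curvature_factor n d s = 0)"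
proof -
  let ?k = "(real n - 2) / (real d + 1)"
  have z: "log_slope n d \<phi> f = (\<lambda>s. q1 s + ?k * p1 s)"
    by (simp add: fun_eq_iff log_slope_def p1_def q1_def)
  have dz: "(log_slope n d \<phi> f has_real_derivative q2 s + ?k * p2 s) (at s)" if "s \<in> I" for s
    unfolding z by (intro DERIV_add DERIV_cmult DERIV_profile that)
  have "(log_slope n d \<phi> f s)\<^sup>2 + 2 / (real d + 1) * deriv (log_slope n d \<phi> f) s
       + (real n + real d - 1) / (real d * (real d + 1)\<^sup>2) *
         (real n * (deriv \<phi> s / \<phi> s)\<^sup>2 - 2 * (deriv (deriv \<phi>) s / \<phi> s)) = 0
     \<longleftrightarrow> curvature_factor n d s = 0" if "s \<in> I" for s
  proof -
    have "real n * (deriv \<phi> s / \<phi> s)\<^sup>2 - 2 * (deriv (deriv \<phi>) s / \<phi> s)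
        = (real n - 2) * (p1 s)\<^sup>2 + 2 * p2 s"
      unfolding p1_def p2_def power2_minus by (simp only: left_diff_distrib right_diff_distrib)
    then show ?thesis
      unfolding DERIV_imp_deriv[OF dz[OF that]] curvature_factor_def
      using assms conformal_riccati[of "real d" "real n" "p2 s" "q2 s" "p1 s" "q1 s"]
      by (simp add: z)
  qed
  then show ?thesis
    unfolding riccati_solution_on_def using dz by (auto simp: real_differentiable_def)
qed

text \<open>The Riccati equation is a local condition, so that representations on all compactly contained
  subintervals imply it on the whole interval.\<close>

lemma riccati_log_slope_iff_representation:
  assumes "I = einterval a b"
  shows "riccati_solution_on I n d \<phi> (log_slope n d \<phi> f) \<longleftrightarrow>
    (\<forall>a' b' :: real. a < ereal a' \<and> a' < b' \<and> ereal b' < b \<longrightarrow>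
       riccati_representation_on {a'<..<b'} n d \<phi> f)"
proof (intro iffI allI impI)
  fix a' b' :: real
  assume ric: "riccati_solution_on I n d \<phi> (log_slope n d \<phi> f)"
    and ab: "a < ereal a' \<and> a' < b' \<and> ereal b' < b"
  have sub: "{a'..b'} \<subseteq> I"
  proof
    fix s assume "s \<in> {a'..b'}"
    then have "ereal a' \<le> ereal s" "ereal s \<le> ereal b'" by simp_all
    then show "s \<in> I" unfolding assms einterval_iff using ab by (meson order.strict_trans1 order.strict_trans2)
  qed
  show "riccati_representation_on {a'<..<b'} n d \<phi> f"
  proof (rule riccati_imp_riccati_representation[OF sub])
    show "riccati_solution_on {a'<..<b'} n d \<phi> (log_slope n d \<phi> f)"
    proof -
      have "{a'<..<b'} \<subseteq> I" using sub by (auto simp: subset_iff)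
      with ric show ?thesis unfolding riccati_solution_on_def by blast
    qed
  qed (use ab smooth_on_imp_DERIV smooth_\<phi> smooth_f \<phi>_pos f_pos in blast)+
next
  assume rep: "\<forall>a' b' :: real. a < ereal a' \<and> a' < b' \<and> ereal b' < b \<longrightarrow>
       riccati_representation_on {a'<..<b'} n d \<phi> f"
  have "\<exists>a' b'. s \<in> {a'<..<b'} \<and> {a'<..<b'} \<subseteq> I \<and>
      riccati_solution_on {a'<..<b'} n d \<phi> (log_slope n d \<phi> f)" if "s \<in> I" for s
  proof -
    have "a < ereal s" "ereal s < b" using that by (auto simp: assms einterval_iff)
    then obtain a' b' where a': "a < ereal a'" "a' < s" and b': "s < b'" "ereal b' < b"
      using ereal_dense2 by (metis less_ereal.simps(1))
    have sub: "{a'<..<b'} \<subseteq> I"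
    proof
      fix t assume "t \<in> {a'<..<b'}"
      then have "ereal a' < ereal t" "ereal t < ereal b'" by simp_all
      then show "t \<in> I" unfolding assms einterval_iff using a' b' by (meson order.strict_trans)
    qed
    have "riccati_representation_on {a'<..<b'} n d \<phi> f" using rep a' b' by simp
    then have "riccati_solution_on {a'<..<b'} n d \<phi> (log_slope n d \<phi> f)"
      using sub by (intro riccati_representation_imp_riccati)
        (auto intro!: smooth_on_imp_DERIV[OF smooth_\<phi>] smooth_on_imp_DERIV[OF smooth_f] \<phi>_pos f_pos)
    then show ?thesis using a' b' sub by (intro exI[of _ a'] exI[of _ b']) simp
  qed
  then show "riccati_solution_on I n d \<phi> (log_slope n d \<phi> f)"
    unfolding riccati_solution_on_def by blast
qed

end

locale conformally_flat_warped_product = warping_profile I \<phi> f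
  for I :: "real set" and \<phi> f :: "real \<Rightarrow> real" +
  fixes \<epsilon> :: "'n::finite \<Rightarrow> real" and \<alpha> :: "real^'n" and F :: "('p, 'i, 'd::finite) metric_manifold"
  assumes sign: "\<And>i. \<epsilon> i = 1 \<or> \<epsilon> i = -1"
    and F: "semi_riemannian_manifold F"
begin

definition U :: "(real^'n) set" where "U = (\<lambda>x. \<alpha> \<bullet> x) -` I"

definition base :: "(real^'n, unit, 'n) metric_manifold" where
  "base = open_submanifold U (\<lambda>x. (1 / (\<phi> (\<alpha> \<bullet> x))\<^sup>2) *\<^sub>R diag_matrix \<epsilon>)"

definition g :: "((real^'n) \<times> 'p, unit \<times> 'i, 'n + 'd) metric_manifold" where
  "g = warped_product base (\<lambda>x. f (\<alpha> \<bullet> x)) F"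

lemma open_U: "open U"
  unfolding U_def by (rule open_vimage[OF open_I]) (intro continuous_intros)

lemma smooth_on_U: "smooth_on I u \<Longrightarrow> smooth_on U (\<lambda>x. u (\<alpha> \<bullet> x))"
  by (rule smooth_on_compose_bounded_linear[OF open_U bounded_linear_inner_right])
     (auto simp: U_def)

lemma semi_riemannian_base: "semi_riemannian_manifold base"
  unfolding base_def
proof (rule semi_riemannian_open_submanifold[OF open_U, where \<nu> = "card {i. \<epsilon> i = -1}"])
  note inv = smooth_on_inverse[OF open_U _ smooth_on_U[OF smooth_\<phi>]]
  have "smooth_on U (\<lambda>x. (inverse (\<phi> (\<alpha> \<bullet> x)) * inverse (\<phi> (\<alpha> \<bullet> x))) *\<^sub>R diag_matrix \<epsilon>)"
    by (intro smooth_on_bilinear[OF open_U bounded_bilinear_scaleR]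
        smooth_on_bilinear[OF open_U bounded_bilinear_mult] inv smooth_on_const[OF open_U])
       (use \<phi>_pos in \<open>force simp: U_def\<close>)+
  then show "smooth_on U (\<lambda>x. (1 / (\<phi> (\<alpha> \<bullet> x))\<^sup>2) *\<^sub>R diag_matrix \<epsilon>)"
    by (simp add: power2_eq_square divide_inverse)
next
  fix x assume "x \<in> U"
  then have "1 / (\<phi> (\<alpha> \<bullet> x))\<^sup>2 > 0" using \<phi>_pos[of "\<alpha> \<bullet> x"] by (simp add: U_def)
  moreover have "invertible (diag_matrix \<epsilon>)"
    using diag_matrix_sign_square[of \<epsilon>] sign unfolding invertible_def by blast
  ultimately show "transpose ((1 / (\<phi> (\<alpha> \<bullet> x))\<^sup>2) *\<^sub>R diag_matrix \<epsilon>) = (1 / (\<phi> (\<alpha> \<bullet> x))\<^sup>2) *\<^sub>R diag_matrix \<epsilon>"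
    "invertible ((1 / (\<phi> (\<alpha> \<bullet> x))\<^sup>2) *\<^sub>R diag_matrix \<epsilon>)"
    "has_index ((1 / (\<phi> (\<alpha> \<bullet> x))\<^sup>2) *\<^sub>R diag_matrix \<epsilon>) (card {i. \<epsilon> i = -1})"
    by (auto simp: transpose_scaleR transpose_diag_matrix intro!: has_index_scaleR invertible_scaleR
        has_index_diag_matrix sign)
qed

lemma smooth_function_base: "smooth_on I u \<Longrightarrow> smooth_function base (\<lambda>x. u (\<alpha> \<bullet> x))"
  unfolding base_def by (intro smooth_function_open_submanifold open_U smooth_on_U)

lemma semi_riemannian_g: "semi_riemannian_manifold g"
  unfolding g_def
  by (rule semi_riemannian_warped_product[OF semi_riemannian_base F smooth_function_base[OF smooth_f]])
     (auto simp: base_def U_def f_pos)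

lemma smooth_function_g: "smooth_on I u \<Longrightarrow> smooth_function g (\<lambda>(x, p). u (\<alpha> \<bullet> x))"
  unfolding g_def
  by (intro smooth_function_warped_product smooth_function_base semi_riemannian_manifoldD(1)
      semi_riemannian_base F)

lemma charts_g: "charts g = {()} \<times> charts F"
  by (simp add: g_def base_def)

lemma cimage_g: "cimage g ((), c) = vec_times U (cimage F c)"
  by (simp add: g_def base_def image_join_vec_Times)

lemma cinv_g:
  assumes "c \<in> charts F" "z \<in> vec_times U (cimage F c)"
  shows "cinv g ((), c) z = (fst_vec z, cinv F c (snd_vec z))"
proof -
  have "cinv g ((), c) z = (cinv base () (fst_vec z), cinv F c (snd_vec z))"
    unfolding g_def
    by (rule cinv_warped_product[OF semi_riemannian_manifoldD(1)[OF semi_riemannian_base]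
          semi_riemannian_manifoldD(1)[OF F] _ assms(1)])
       (use assms(2) in \<open>simp_all add: base_def\<close>)
  also have "cinv base () (fst_vec z) = fst_vec z"
    using assms(2) by (simp add: base_def vec_times_def)
  finally show ?thesis .
qed

lemma scalar_curvature_g:
  assumes c: "c \<in> charts F" and z: "z \<in> cimage g ((), c)"
  shows "scalar_curvature g ((), c) z
    = scalar_curvature F c (snd_vec z) / (f (\<alpha> \<bullet> fst_vec z))\<^sup>2
      - (\<Sum>i\<in>UNIV. \<epsilon> i * (\<alpha> $ i)\<^sup>2) * (\<phi> (\<alpha> \<bullet> fst_vec z))\<^sup>2
         * curvature_factor CARD('n) CARD('d) (\<alpha> \<bullet> fst_vec z)"
proof -
  interpret wc: warped_coordinates I "cimage F c" \<epsilon> \<alpha> p p1 p2 q q1 q2 "metric F c" "metric g ((), c)"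
  proof
    show "open (cimage F c)" by (rule chart_properties(2)[OF semi_riemannian_manifoldD(1)[OF F] c])
    fix z :: "real^('n + 'd)"
    assume z: "\<alpha> \<bullet> fst_vec z \<in> I" "snd_vec z \<in> cimage F c"
    let ?s = "\<alpha> \<bullet> fst_vec z"
    have "exp (2 * p ?s) = 1 / (\<phi> ?s)\<^sup>2" "exp (2 * q ?s) = (f ?s)\<^sup>2"
      using \<phi>_pos[OF z(1)] f_pos[OF z(1)]
      by (simp_all add: p_def q_def exp_minus exp_double divide_inverse power_inverse)
    moreover have "fst_vec z \<in> U" using z(1) by (simp add: U_def)
    ultimately show "metric g ((), c) z = block_diag (exp (2 * p ?s) *\<^sub>R diag_matrix \<epsilon>)
        (exp (2 * q ?s) *\<^sub>R metric F c (snd_vec z))"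
      by (simp add: g_def base_def)
  qed (use open_I sign DERIV_profile semi_riemannian_manifoldD[OF F] c in auto)
  have zW: "z \<in> wc.W" using z unfolding cimage_g by (auto simp: vec_times_def U_def wc.W_def)
  let ?s = "\<alpha> \<bullet> fst_vec z"
  have s: "?s \<in> I" using wc.WD(1)[OF zW] .
  have "exp (- 2 * p ?s) = (\<phi> ?s)\<^sup>2" "exp (- 2 * q ?s) = 1 / (f ?s)\<^sup>2"
    using \<phi>_pos[OF s] f_pos[OF s]
    by (simp_all add: p_def q_def exp_minus exp_double divide_inverse power_inverse)
  then show ?thesis
    using wc.scalar_curvature_trace[OF zW]
    by (simp add: scalar_curvature_def curvature_factor_def wc.N_def)
qed

text \<open>Both factors in front of the bracket are nonzero. The points of a chart of the product cover all
  values of \<open>\<xi>\<close> in the interval, because \<open>\<alpha> \<noteq> 0\<close> and the fibre is not empty.\<close>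

lemma scalar_flat_g_iff:
  assumes "has_constant_scalar_curvature F 0" "topspace (mtop F) \<noteq> {}"
    and N: "(\<Sum>i\<in>UNIV. \<epsilon> i * (\<alpha> $ i)\<^sup>2) \<noteq> 0"
  shows "has_constant_scalar_curvature g 0
    \<longleftrightarrow> (\<forall>s\<in>I. curvature_factor CARD('n) CARD('d) s = 0)"
proof -
  have flat: "scalar_curvature g ((), c) z = 0 \<longleftrightarrow> curvature_factor CARD('n) CARD('d) (\<alpha> \<bullet> fst_vec z) = 0"
    if c: "c \<in> charts F" and z: "z \<in> cimage g ((), c)" for c z
  proof -
    have z': "\<alpha> \<bullet> fst_vec z \<in> I" "snd_vec z \<in> cimage F c"
      using z unfolding cimage_g by (auto simp: vec_times_def U_def)
    have "scalar_curvature F c (snd_vec z) = 0"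
      using assms(1) c z'(2) unfolding has_constant_scalar_curvature_def by blast
    then show ?thesis
      using scalar_curvature_g[OF c z] \<phi>_pos[OF z'(1)] N by simp
  qed
  obtain c y where c: "c \<in> charts F" and y: "y \<in> cimage F c"
    using assms(2) semi_riemannian_manifoldD(1)[OF F] unfolding smooth_manifold_def by auto
  have "\<alpha> \<noteq> 0" using N by auto
  show ?thesis
  proof
    assume g0: "has_constant_scalar_curvature g 0"
    show "\<forall>s\<in>I. curvature_factor CARD('n) CARD('d) s = 0"
    proof
      fix s assume "s \<in> I"
      \<comment> \<open>the point of the line through \<open>\<alpha>\<close> on the hyperplane \<open>\<xi> = s\<close>\<close>
      define x where "x = (s / (\<alpha> \<bullet> \<alpha>)) *\<^sub>R \<alpha>"
      have x: "\<alpha> \<bullet> x = s" using \<open>\<alpha> \<noteq> 0\<close> by (simp add: x_def)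
      have z: "join_vec x y \<in> cimage g ((), c)"
        unfolding cimage_g using x y \<open>s \<in> I\<close> by (simp add: vec_times_def U_def)
      then have "scalar_curvature g ((), c) (join_vec x y) = 0"
        using g0 c unfolding has_constant_scalar_curvature_def charts_g by blast
      then show "curvature_factor CARD('n) CARD('d) s = 0" using flat[OF c z] x by simp
    qed
  next
    assume "\<forall>s\<in>I. curvature_factor CARD('n) CARD('d) s = 0"
    moreover have "\<alpha> \<bullet> fst_vec z \<in> I" if "z \<in> cimage g ((), c)" for z c
      using that unfolding cimage_g by (auto simp: vec_times_def U_def)
    ultimately show "has_constant_scalar_curvature g 0"
      unfolding has_constant_scalar_curvature_def charts_g using flat by blast
  qed
qed

end

section \<open>Steady solitons of constant potential on warped products\<close>

lemma deriv_zero_einterval_iff: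
  assumes "smooth_on (einterval a b) h"
  shows "(\<forall>s\<in>einterval a b. deriv h s = 0) \<longleftrightarrow> (\<exists>k. \<forall>s\<in>einterval a b. h s = k)"
proof
  assume "\<forall>s\<in>einterval a b. deriv h s = 0"
  then have "(h has_real_derivative 0) (at s within einterval a b)" if "s \<in> einterval a b" for s
    using smooth_on_imp_DERIV[OF assms that] that by (auto intro: DERIV_subset)
  moreover have "convex (einterval a b)"
    unfolding is_interval_convex_1[symmetric] is_interval_1
  proof (intro ballI allI impI)
    fix r t s assume "r \<in> einterval a b" "t \<in> einterval a b" and s: "r \<le> s \<and> s \<le> t"
    then have "a < ereal r" "ereal t < b" by (simp_all add: einterval_iff)
    moreover have "ereal r \<le> ereal s" "ereal s \<le> ereal t" using s by simp_all
    ultimately show "s \<in> einterval a b"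
      unfolding einterval_iff by (intro conjI) (rule less_le_trans, assumption+, rule le_less_trans)
  qed
  ultimately show "\<exists>k. \<forall>s\<in>einterval a b. h s = k"
    using has_field_derivative_zero_constant by blast
next
  assume "\<exists>k. \<forall>s\<in>einterval a b. h s = k"
  then obtain k where k: "\<And>s. s \<in> einterval a b \<Longrightarrow> h s = k" by blast
  show "\<forall>s\<in>einterval a b. deriv h s = 0"
  proof
    fix s assume s: "s \<in> einterval a b"
    have "(h has_real_derivative 0) (at s)"
      by (rule has_field_derivative_transform_within_open[OF DERIV_const open_einterval s]) (simp add: k)
    then show "deriv h s = 0" by (rule DERIV_imp_deriv)
  qed
qed

theorem theorem1p11:
  fixes \<epsilon> :: "'n::finite \<Rightarrow> real"
    and \<alpha> :: "real^'n"
    and F :: "('p, 'i, 'd::finite) metric_manifold"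
    and a b :: ereal
    and \<phi> f h :: "real \<Rightarrow> real"
  defines "\<xi> \<equiv> (\<lambda>x::real^'n. \<Sum>i\<in>UNIV. \<alpha> $ i * x $ i)"
  defines "I \<equiv> einterval a b"
  defines "g \<equiv> warped_product
                 (open_submanifold (\<xi> -` I) (\<lambda>x. (1 / (\<phi> (\<xi> x))\<^sup>2) *\<^sub>R diag_matrix \<epsilon>))
                 (\<lambda>x. f (\<xi> x)) F"
  assumes "CARD('n) \<ge> 3" and "CARD('d) \<ge> 1"
    and "\<And>i. \<epsilon> i = 1 \<or> \<epsilon> i = -1"
    and "semi_riemannian_manifold F" and "topspace (mtop F) \<noteq> {}"
    and "has_constant_scalar_curvature F 0"
    and "\<alpha> \<noteq> 0" and "(\<Sum>i\<in>UNIV. \<epsilon> i * (\<alpha> $ i)\<^sup>2) \<noteq> 0"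
    and "a < b"
    and "smooth_on I \<phi>" and "\<And>s. s \<in> I \<Longrightarrow> \<phi> s > 0"
    and "smooth_on I f" and "\<And>s. s \<in> I \<Longrightarrow> f s > 0"
    and "smooth_on I h" and "\<And>s. s \<in> I \<Longrightarrow> h s > 0"
  shows "steady_gradient_yamabe_soliton g (\<lambda>(x, p). h (\<xi> x)) \<and> (\<forall>s\<in>I. deriv h s = 0)
     \<longleftrightarrow>
       (\<exists>k. \<forall>s\<in>I. h s = k) \<and>
       (\<forall>a' b' :: real. a < ereal a' \<and> a' < b' \<and> ereal b' < b \<longrightarrow>
          riccati_representation_on {a'<..<b'} CARD('n) CARD('d) \<phi> f)"
proof -
  interpret M: conformally_flat_warped_product I \<phi> f \<epsilon> \<alpha> F
    by unfold_locales (use assms in \<open>auto simp: I_def\<close>)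
  have \<xi>: "\<xi> = (\<lambda>x. \<alpha> \<bullet> x)" by (simp add: \<xi>_def inner_vec_def)
  have g: "g = M.g" by (simp add: g_def \<xi> M.g_def M.base_def M.U_def)
  have soliton: "steady_gradient_yamabe_soliton g (\<lambda>(x, p). h (\<xi> x)) \<longleftrightarrow>
      (\<forall>a' b' :: real. a < ereal a' \<and> a' < b' \<and> ereal b' < b \<longrightarrow>
          riccati_representation_on {a'<..<b'} CARD('n) CARD('d) \<phi> f)"
    if k: "\<forall>s\<in>I. h s = k" for k
  proof -
    have const: "(\<lambda>(x, p). h (\<alpha> \<bullet> x)) (cinv M.g c z) = k"
      if cz: "c \<in> charts M.g" "z \<in> cimage M.g c" for c z
    proof -
      obtain j where j: "c = ((), j)" "j \<in> charts F" using cz(1) by (auto simp: M.charts_g)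
      have "z \<in> vec_times M.U (cimage F j)" using cz(2) unfolding j M.cimage_g .
      then show ?thesis using k by (auto simp: j M.cinv_g vec_times_def M.U_def)
    qed
    have "steady_gradient_yamabe_soliton g (\<lambda>(x, p). h (\<xi> x)) \<longleftrightarrow> has_constant_scalar_curvature M.g 0"
      unfolding g \<xi>
      by (rule steady_soliton_of_constant_iff[OF M.semi_riemannian_g M.smooth_function_g const])
         (use assms in auto)
    also have "\<dots> \<longleftrightarrow> riccati_solution_on I CARD('n) CARD('d) \<phi> (log_slope CARD('n) CARD('d) \<phi> f)"
      using assms M.scalar_flat_g_iff M.riccati_log_slope_iff[of "CARD('d)" "CARD('n)"] by simp
    finally show ?thesis using M.riccati_log_slope_iff_representation[OF I_def[THEN meta_eq_to_obj_eq]] by simp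
  qed
  have "(\<forall>s\<in>I. deriv h s = 0) \<longleftrightarrow> (\<exists>k. \<forall>s\<in>I. h s = k)"
    using assms unfolding I_def by (intro deriv_zero_einterval_iff)
  then show ?thesis using soliton by blast
qed

end
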